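(* Let $\mathcal{C}$ be a semi-monoidal 2-category. The 2-category of units in $\mathcal{C}$ is contractible if non-empty. In other words, between any two units in $\mathcal{C}$ there exists a unit morphism, and between any two parallel unit morphisms there is a unique unit 2-morphism.
   Context: A semi-monoidal 2-category $\mathcal{C}$ is a strict 2-category with a strict 2-functor $\mathcal{C}\times\mathcal{C}\to\mathcal{C}$, $(X,Y)\mapsto XY$ (tensor product, written by juxtaposition), strictly associative. No unit is assumed. $\#$ denotes composition of arrows and horizontal composition of 2-cells (including whiskering), written left to right; $\bullet$ denotes vertical composition of 2-cells, also left to right. An equi-arrow is an arrow admitting a pseudo-inverse. An object $I$ is cancellable if the 2-functors $X\mapsto IX$ and $X\mapsto XI$ from $\mathcal{C}$ to $\mathcal{C}$ are fully faithful, i.e. induce equivalences on hom categories. The 2-category of units in $\mathcal{C}$: a unit (object) is a pair $(I,\alpha)$ with $I$ a cancellable object and $\alpha: II\to I$ an equi-arrow. A unit morphism $(I,\alpha)\to(J,\beta)$ is a pair $(u,U)$ with $u:I\to J$ an equi-arrow and $U:\alpha\#u\Rightarrow uu\#\beta$ an invertible 2-cell. A unit 2-morphism $(u,U)\Rightarrow(v,V)$ between morphisms $(I,\alpha)\to(J,\beta)$ is an invertible 2-cell $T:u\Rightarrow v$ such that $U\bullet(TT\,\#\,\beta)=(\alpha\,\#\,T)\bullet V$. *)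

theory Defs
  imports Main
begin

section \<open>Categories, functors and equivalences of categories\<close>

text \<open>Composition is written in diagrammatic (left-to-right) order throughout.\<close>

record ('o, 'a) cat =
  Ob   :: "'o set"
  Ar   :: "'a set"
  Dom  :: "'a \<Rightarrow> 'o"
  Cod  :: "'a \<Rightarrow> 'o"
  Idt  :: "'o \<Rightarrow> 'a"
  Cmp  :: "'a \<Rightarrow> 'a \<Rightarrow> 'a"

locale category =
  fixes K :: "('o, 'a, 'm) cat_scheme"
  assumes Dom_closed: "f \<in> Ar K \<Longrightarrow> Dom K f \<in> Ob K"
    and Cod_closed: "f \<in> Ar K \<Longrightarrow> Cod K f \<in> Ob K"
    and Idt_closed: "x \<in> Ob K \<Longrightarrow> Idt K x \<in> Ar K"
    and Dom_Idt: "x \<in> Ob K \<Longrightarrow> Dom K (Idt K x) = x"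
    and Cod_Idt: "x \<in> Ob K \<Longrightarrow> Cod K (Idt K x) = x"
    and Cmp_closed: "\<lbrakk>f \<in> Ar K; g \<in> Ar K; Cod K f = Dom K g\<rbrakk> \<Longrightarrow> Cmp K f g \<in> Ar K"
    and Dom_Cmp: "\<lbrakk>f \<in> Ar K; g \<in> Ar K; Cod K f = Dom K g\<rbrakk> \<Longrightarrow> Dom K (Cmp K f g) = Dom K f"
    and Cod_Cmp: "\<lbrakk>f \<in> Ar K; g \<in> Ar K; Cod K f = Dom K g\<rbrakk> \<Longrightarrow> Cod K (Cmp K f g) = Cod K g"
    and Cmp_Idt_left: "f \<in> Ar K \<Longrightarrow> Cmp K (Idt K (Dom K f)) f = f"
    and Cmp_Idt_right: "f \<in> Ar K \<Longrightarrow> Cmp K f (Idt K (Cod K f)) = f"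
    and Cmp_assoc:
      "\<lbrakk>f \<in> Ar K; g \<in> Ar K; h \<in> Ar K; Cod K f = Dom K g; Cod K g = Dom K h\<rbrakk>
        \<Longrightarrow> Cmp K (Cmp K f g) h = Cmp K f (Cmp K g h)"

locale cat_functor = K: category K + L: category L
  for K :: "('o, 'a, 'm) cat_scheme" and L :: "('o', 'a', 'm') cat_scheme" +
  fixes F0 :: "'o \<Rightarrow> 'o'" and F1 :: "'a \<Rightarrow> 'a'"
  assumes F0_closed: "x \<in> Ob K \<Longrightarrow> F0 x \<in> Ob L"
    and F1_closed: "f \<in> Ar K \<Longrightarrow> F1 f \<in> Ar L"
    and F1_Dom: "f \<in> Ar K \<Longrightarrow> Dom L (F1 f) = F0 (Dom K f)"
    and F1_Cod: "f \<in> Ar K \<Longrightarrow> Cod L (F1 f) = F0 (Cod K f)"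
    and F1_Idt: "x \<in> Ob K \<Longrightarrow> F1 (Idt K x) = Idt L (F0 x)"
    and F1_Cmp: "\<lbrakk>f \<in> Ar K; g \<in> Ar K; Cod K f = Dom K g\<rbrakk>
        \<Longrightarrow> F1 (Cmp K f g) = Cmp L (F1 f) (F1 g)"

definition iso_arrow :: "('o, 'a, 'm) cat_scheme \<Rightarrow> 'a \<Rightarrow> bool" where
  "iso_arrow K f \<longleftrightarrow> f \<in> Ar K \<and>
     (\<exists>g \<in> Ar K. Dom K g = Cod K f \<and> Cod K g = Dom K f \<and>
        Cmp K f g = Idt K (Dom K f) \<and> Cmp K g f = Idt K (Cod K f))"

definition natural_iso ::
  "('o, 'a, 'm) cat_scheme \<Rightarrow> ('o', 'a', 'm') cat_scheme \<Rightarrow>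
   ('o \<Rightarrow> 'o') \<Rightarrow> ('a \<Rightarrow> 'a') \<Rightarrow> ('o \<Rightarrow> 'o') \<Rightarrow> ('a \<Rightarrow> 'a') \<Rightarrow> ('o \<Rightarrow> 'a') \<Rightarrow> bool" where
  "natural_iso K L F0 F1 G0 G1 \<eta> \<longleftrightarrow>
     cat_functor K L F0 F1 \<and> cat_functor K L G0 G1 \<and>
     (\<forall>x \<in> Ob K. iso_arrow L (\<eta> x) \<and> Dom L (\<eta> x) = F0 x \<and> Cod L (\<eta> x) = G0 x) \<and>
     (\<forall>f \<in> Ar K. Cmp L (F1 f) (\<eta> (Cod K f)) = Cmp L (\<eta> (Dom K f)) (G1 f))"

definition cat_equivalence ::
  "('o, 'a, 'm) cat_scheme \<Rightarrow> ('o', 'a', 'm') cat_scheme \<Rightarrow>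
   ('o \<Rightarrow> 'o') \<Rightarrow> ('a \<Rightarrow> 'a') \<Rightarrow> bool" where
  "cat_equivalence K L F0 F1 \<longleftrightarrow> cat_functor K L F0 F1 \<and>
     (\<exists>G0 G1 \<eta> \<epsilon>. cat_functor L K G0 G1 \<and>
        natural_iso K K id id (G0 \<circ> F0) (G1 \<circ> F1) \<eta> \<and>
        natural_iso L L (F0 \<circ> G0) (F1 \<circ> G1) id id \<epsilon>)"


section \<open>Strict 2-categories\<close>

text \<open>
  \<open>f \<sharp> g\<close> is composition of arrows, \<open>S \<star> T\<close> is horizontal and \<open>S \<bullet> T\<close> is vertical
  composition of 2-cells. Whiskering by an arrow \<open>f\<close> is horizontal composition with the
  identity 2-cell \<open>cid f\<close>.
\<close>

record ('o, 'a, 'c) two_cat =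
  Obj   :: "'o set"
  Arr   :: "'a set"
  Cell  :: "'c set"
  adom  :: "'a \<Rightarrow> 'o"
  acod  :: "'a \<Rightarrow> 'o"
  csrc  :: "'c \<Rightarrow> 'a"
  ctrg  :: "'c \<Rightarrow> 'a"
  aid   :: "'o \<Rightarrow> 'a"
  cid   :: "'a \<Rightarrow> 'c"
  acomp :: "'a \<Rightarrow> 'a \<Rightarrow> 'a" (infixl "\<sharp>\<index>" 70)
  hcomp :: "'c \<Rightarrow> 'c \<Rightarrow> 'c" (infixl "\<star>\<index>" 70)
  vcomp :: "'c \<Rightarrow> 'c \<Rightarrow> 'c" (infixl "\<bullet>\<index>" 65)

definition arr_in :: "('o, 'a, 'c, 'm) two_cat_scheme \<Rightarrow> 'a \<Rightarrow> 'o \<Rightarrow> 'o \<Rightarrow> bool" where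
  "arr_in C f X Y \<longleftrightarrow> f \<in> Arr C \<and> adom C f = X \<and> acod C f = Y"

definition cell_in :: "('o, 'a, 'c, 'm) two_cat_scheme \<Rightarrow> 'c \<Rightarrow> 'a \<Rightarrow> 'a \<Rightarrow> bool" where
  "cell_in C T f g \<longleftrightarrow> T \<in> Cell C \<and> csrc C T = f \<and> ctrg C T = g"

locale strict_2category =
  fixes C :: "('o, 'a, 'c, 'm) two_cat_scheme" (structure)
  assumes adom_closed: "f \<in> Arr C \<Longrightarrow> adom C f \<in> Obj C"
    and acod_closed: "f \<in> Arr C \<Longrightarrow> acod C f \<in> Obj C"
    and csrc_closed: "T \<in> Cell C \<Longrightarrow> csrc C T \<in> Arr C"
    and ctrg_closed: "T \<in> Cell C \<Longrightarrow> ctrg C T \<in> Arr C"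
    and parallel_dom: "T \<in> Cell C \<Longrightarrow> adom C (ctrg C T) = adom C (csrc C T)"
    and parallel_cod: "T \<in> Cell C \<Longrightarrow> acod C (ctrg C T) = acod C (csrc C T)"
    and aid_in: "X \<in> Obj C \<Longrightarrow> arr_in C (aid C X) X X"
    and cid_in: "f \<in> Arr C \<Longrightarrow> cell_in C (cid C f) f f"
    and acomp_in: "\<lbrakk>f \<in> Arr C; g \<in> Arr C; acod C f = adom C g\<rbrakk>
        \<Longrightarrow> arr_in C (f \<sharp> g) (adom C f) (acod C g)"
    and vcomp_in: "\<lbrakk>S \<in> Cell C; T \<in> Cell C; ctrg C S = csrc C T\<rbrakk>
        \<Longrightarrow> cell_in C (S \<bullet> T) (csrc C S) (ctrg C T)"
    and hcomp_in: "\<lbrakk>S \<in> Cell C; T \<in> Cell C; acod C (csrc C S) = adom C (csrc C T)\<rbrakk>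
        \<Longrightarrow> cell_in C (S \<star> T) (csrc C S \<sharp> csrc C T) (ctrg C S \<sharp> ctrg C T)"
    and acomp_aid_left: "f \<in> Arr C \<Longrightarrow> aid C (adom C f) \<sharp> f = f"
    and acomp_aid_right: "f \<in> Arr C \<Longrightarrow> f \<sharp> aid C (acod C f) = f"
    and acomp_assoc: "\<lbrakk>f \<in> Arr C; g \<in> Arr C; h \<in> Arr C; acod C f = adom C g; acod C g = adom C h\<rbrakk>
        \<Longrightarrow> (f \<sharp> g) \<sharp> h = f \<sharp> (g \<sharp> h)"
    and vcomp_cid_left: "T \<in> Cell C \<Longrightarrow> cid C (csrc C T) \<bullet> T = T"
    and vcomp_cid_right: "T \<in> Cell C \<Longrightarrow> T \<bullet> cid C (ctrg C T) = T"
    and vcomp_assoc: "\<lbrakk>R \<in> Cell C; S \<in> Cell C; T \<in> Cell C; ctrg C R = csrc C S; ctrg C S = csrc C T\<rbrakk>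
        \<Longrightarrow> (R \<bullet> S) \<bullet> T = R \<bullet> (S \<bullet> T)"
    and hcomp_aid_left: "T \<in> Cell C \<Longrightarrow> cid C (aid C (adom C (csrc C T))) \<star> T = T"
    and hcomp_aid_right: "T \<in> Cell C \<Longrightarrow> T \<star> cid C (aid C (acod C (csrc C T))) = T"
    and hcomp_assoc: "\<lbrakk>R \<in> Cell C; S \<in> Cell C; T \<in> Cell C;
          acod C (csrc C R) = adom C (csrc C S); acod C (csrc C S) = adom C (csrc C T)\<rbrakk>
        \<Longrightarrow> (R \<star> S) \<star> T = R \<star> (S \<star> T)"
    and hcomp_cid: "\<lbrakk>f \<in> Arr C; g \<in> Arr C; acod C f = adom C g\<rbrakk>
        \<Longrightarrow> cid C f \<star> cid C g = cid C (f \<sharp> g)"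
    and interchange: "\<lbrakk>S \<in> Cell C; S' \<in> Cell C; T \<in> Cell C; T' \<in> Cell C;
          ctrg C S = csrc C S'; ctrg C T = csrc C T'; acod C (csrc C S) = adom C (csrc C T)\<rbrakk>
        \<Longrightarrow> (S \<bullet> S') \<star> (T \<bullet> T') = (S \<star> T) \<bullet> (S' \<star> T')"

definition invertible_cell :: "('o, 'a, 'c, 'm) two_cat_scheme \<Rightarrow> 'c \<Rightarrow> bool" where
  "invertible_cell C T \<longleftrightarrow> T \<in> Cell C \<and>
     (\<exists>S. cell_in C S (ctrg C T) (csrc C T) \<and>
        T \<bullet>\<^bsub>C\<^esub> S = cid C (csrc C T) \<and> S \<bullet>\<^bsub>C\<^esub> T = cid C (ctrg C T))"

definition equi_arrow :: "('o, 'a, 'c, 'm) two_cat_scheme \<Rightarrow> 'a \<Rightarrow> bool" where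
  "equi_arrow C f \<longleftrightarrow> f \<in> Arr C \<and>
     (\<exists>g S T. arr_in C g (acod C f) (adom C f) \<and>
        invertible_cell C S \<and> cell_in C S (f \<sharp>\<^bsub>C\<^esub> g) (aid C (adom C f)) \<and>
        invertible_cell C T \<and> cell_in C T (g \<sharp>\<^bsub>C\<^esub> f) (aid C (acod C f)))"

definition hom_cat :: "('o, 'a, 'c, 'm) two_cat_scheme \<Rightarrow> 'o \<Rightarrow> 'o \<Rightarrow> ('a, 'c) cat" where
  "hom_cat C X Y =
     \<lparr>Ob = {f. arr_in C f X Y}, Ar = {T \<in> Cell C. arr_in C (csrc C T) X Y},
      Dom = csrc C, Cod = ctrg C, Idt = cid C, Cmp = vcomp C\<rparr>"


section \<open>Strict 2-functors\<close>

locale two_functor = C: strict_2category C + D: strict_2category D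
  for C :: "('o, 'a, 'c, 'm) two_cat_scheme" and D :: "('o', 'a', 'c', 'm') two_cat_scheme" +
  fixes F0 :: "'o \<Rightarrow> 'o'" and F1 :: "'a \<Rightarrow> 'a'" and F2 :: "'c \<Rightarrow> 'c'"
  assumes map_obj: "X \<in> Obj C \<Longrightarrow> F0 X \<in> Obj D"
    and map_arr: "f \<in> Arr C \<Longrightarrow> arr_in D (F1 f) (F0 (adom C f)) (F0 (acod C f))"
    and map_cell: "T \<in> Cell C \<Longrightarrow> cell_in D (F2 T) (F1 (csrc C T)) (F1 (ctrg C T))"
    and map_aid: "X \<in> Obj C \<Longrightarrow> F1 (aid C X) = aid D (F0 X)"
    and map_cid: "f \<in> Arr C \<Longrightarrow> F2 (cid C f) = cid D (F1 f)"
    and map_acomp: "\<lbrakk>f \<in> Arr C; g \<in> Arr C; acod C f = adom C g\<rbrakk>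
        \<Longrightarrow> F1 (f \<sharp>\<^bsub>C\<^esub> g) = F1 f \<sharp>\<^bsub>D\<^esub> F1 g"
    and map_vcomp: "\<lbrakk>S \<in> Cell C; T \<in> Cell C; ctrg C S = csrc C T\<rbrakk>
        \<Longrightarrow> F2 (S \<bullet>\<^bsub>C\<^esub> T) = F2 S \<bullet>\<^bsub>D\<^esub> F2 T"
    and map_hcomp: "\<lbrakk>S \<in> Cell C; T \<in> Cell C; acod C (csrc C S) = adom C (csrc C T)\<rbrakk>
        \<Longrightarrow> F2 (S \<star>\<^bsub>C\<^esub> T) = F2 S \<star>\<^bsub>D\<^esub> F2 T"

definition fully_faithful_2functor ::
  "('o, 'a, 'c, 'm) two_cat_scheme \<Rightarrow> ('o', 'a', 'c', 'm') two_cat_scheme \<Rightarrow>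
   ('o \<Rightarrow> 'o') \<Rightarrow> ('a \<Rightarrow> 'a') \<Rightarrow> ('c \<Rightarrow> 'c') \<Rightarrow> bool" where
  "fully_faithful_2functor C D F0 F1 F2 \<longleftrightarrow> two_functor C D F0 F1 F2 \<and>
     (\<forall>X \<in> Obj C. \<forall>Y \<in> Obj C.
        cat_equivalence (hom_cat C X Y) (hom_cat D (F0 X) (F0 Y)) F1 F2)"

definition equivalence_2functor ::
  "('o, 'a, 'c, 'm) two_cat_scheme \<Rightarrow> ('o', 'a', 'c', 'm') two_cat_scheme \<Rightarrow>
   ('o \<Rightarrow> 'o') \<Rightarrow> ('a \<Rightarrow> 'a') \<Rightarrow> ('c \<Rightarrow> 'c') \<Rightarrow> bool" where
  "equivalence_2functor C D F0 F1 F2 \<longleftrightarrow> fully_faithful_2functor C D F0 F1 F2 \<and>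
     (\<forall>Y \<in> Obj D. \<exists>X \<in> Obj C. \<exists>f. equi_arrow D f \<and> arr_in D f (F0 X) Y)"

definition terminal_2cat :: "(unit, unit, unit) two_cat" where
  "terminal_2cat =
     \<lparr>Obj = UNIV, Arr = UNIV, Cell = UNIV,
      adom = (\<lambda>_. ()), acod = (\<lambda>_. ()), csrc = (\<lambda>_. ()), ctrg = (\<lambda>_. ()),
      aid = (\<lambda>_. ()), cid = (\<lambda>_. ()),
      acomp = (\<lambda>_ _. ()), hcomp = (\<lambda>_ _. ()), vcomp = (\<lambda>_ _. ())\<rparr>"

text \<open>Essential surjectivity onto the terminal 2-category amounts to having at least one object.\<close>

definition contractible_2cat :: "('o, 'a, 'c, 'm) two_cat_scheme \<Rightarrow> bool" where
  "contractible_2cat C \<longleftrightarrow>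
     equivalence_2functor C terminal_2cat (\<lambda>_. ()) (\<lambda>_. ()) (\<lambda>_. ())"


section \<open>Semi-monoidal 2-categories\<close>

definition prod_2cat ::
  "('o, 'a, 'c, 'm) two_cat_scheme \<Rightarrow> ('o', 'a', 'c', 'm') two_cat_scheme \<Rightarrow>
   ('o \<times> 'o', 'a \<times> 'a', 'c \<times> 'c') two_cat" where
  "prod_2cat C D =
     \<lparr>Obj = Obj C \<times> Obj D, Arr = Arr C \<times> Arr D, Cell = Cell C \<times> Cell D,
      adom = map_prod (adom C) (adom D), acod = map_prod (acod C) (acod D),
      csrc = map_prod (csrc C) (csrc D), ctrg = map_prod (ctrg C) (ctrg D),
      aid = map_prod (aid C) (aid D), cid = map_prod (cid C) (cid D),
      acomp = (\<lambda>(f, f') (g, g'). (f \<sharp>\<^bsub>C\<^esub> g, f' \<sharp>\<^bsub>D\<^esub> g')),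
      hcomp = (\<lambda>(S, S') (T, T'). (S \<star>\<^bsub>C\<^esub> T, S' \<star>\<^bsub>D\<^esub> T')),
      vcomp = (\<lambda>(S, S') (T, T'). (S \<bullet>\<^bsub>C\<^esub> T, S' \<bullet>\<^bsub>D\<^esub> T'))\<rparr>"

record ('o, 'a, 'c) semi_mon_2cat = "('o, 'a, 'c) two_cat" +
  otens :: "'o \<Rightarrow> 'o \<Rightarrow> 'o" (infixl "\<odot>\<index>" 75)
  atens :: "'a \<Rightarrow> 'a \<Rightarrow> 'a" (infixl "\<otimes>\<index>" 75)
  ctens :: "'c \<Rightarrow> 'c \<Rightarrow> 'c" (infixl "\<boxtimes>\<index>" 75)

locale semi_monoidal_2category = strict_2category C
  for C :: "('o, 'a, 'c, 'm) semi_mon_2cat_scheme" (structure) +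
  assumes tensor_2functor:
      "two_functor (prod_2cat C C) C
         (\<lambda>(X, Y). X \<odot> Y) (\<lambda>(f, g). f \<otimes> g) (\<lambda>(S, T). S \<boxtimes> T)"
    and otens_assoc: "\<lbrakk>X \<in> Obj C; Y \<in> Obj C; Z \<in> Obj C\<rbrakk>
        \<Longrightarrow> (X \<odot> Y) \<odot> Z = X \<odot> (Y \<odot> Z)"
    and atens_assoc: "\<lbrakk>f \<in> Arr C; g \<in> Arr C; h \<in> Arr C\<rbrakk>
        \<Longrightarrow> (f \<otimes> g) \<otimes> h = f \<otimes> (g \<otimes> h)"
    and ctens_assoc: "\<lbrakk>R \<in> Cell C; S \<in> Cell C; T \<in> Cell C\<rbrakk>
        \<Longrightarrow> (R \<boxtimes> S) \<boxtimes> T = R \<boxtimes> (S \<boxtimes> T)"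


section \<open>The 2-category of units\<close>

text \<open>Tensoring an arrow or a 2-cell with an object \<open>I\<close> means tensoring with its identity.\<close>

definition cancellable :: "('o, 'a, 'c, 'm) semi_mon_2cat_scheme \<Rightarrow> 'o \<Rightarrow> bool" where
  "cancellable C I \<longleftrightarrow> I \<in> Obj C \<and>
     fully_faithful_2functor C C
       (\<lambda>X. I \<odot>\<^bsub>C\<^esub> X) (\<lambda>f. aid C I \<otimes>\<^bsub>C\<^esub> f) (\<lambda>T. cid C (aid C I) \<boxtimes>\<^bsub>C\<^esub> T) \<and>
     fully_faithful_2functor C C
       (\<lambda>X. X \<odot>\<^bsub>C\<^esub> I) (\<lambda>f. f \<otimes>\<^bsub>C\<^esub> aid C I) (\<lambda>T. T \<boxtimes>\<^bsub>C\<^esub> cid C (aid C I))"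

definition unit_object :: "('o, 'a, 'c, 'm) semi_mon_2cat_scheme \<Rightarrow> 'o \<times> 'a \<Rightarrow> bool" where
  "unit_object C = (\<lambda>(I, \<alpha>).
     cancellable C I \<and> equi_arrow C \<alpha> \<and> arr_in C \<alpha> (I \<odot>\<^bsub>C\<^esub> I) I)"

definition unit_morphism ::
  "('o, 'a, 'c, 'm) semi_mon_2cat_scheme \<Rightarrow> 'o \<times> 'a \<Rightarrow> 'o \<times> 'a \<Rightarrow> 'a \<times> 'c \<Rightarrow> bool" where
  "unit_morphism C = (\<lambda>(I, \<alpha>) (J, \<beta>) (u, U).
     unit_object C (I, \<alpha>) \<and> unit_object C (J, \<beta>) \<and>
     equi_arrow C u \<and> arr_in C u I J \<and>
     invertible_cell C U \<and> cell_in C U (\<alpha> \<sharp>\<^bsub>C\<^esub> u) ((u \<otimes>\<^bsub>C\<^esub> u) \<sharp>\<^bsub>C\<^esub> \<beta>))"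

definition unit_2morphism ::
  "('o, 'a, 'c, 'm) semi_mon_2cat_scheme \<Rightarrow> 'o \<times> 'a \<Rightarrow> 'o \<times> 'a \<Rightarrow>
   'a \<times> 'c \<Rightarrow> 'a \<times> 'c \<Rightarrow> 'c \<Rightarrow> bool" where
  "unit_2morphism C = (\<lambda>(I, \<alpha>) (J, \<beta>) (u, U) (v, V) T.
     unit_morphism C (I, \<alpha>) (J, \<beta>) (u, U) \<and> unit_morphism C (I, \<alpha>) (J, \<beta>) (v, V) \<and>
     invertible_cell C T \<and> cell_in C T u v \<and>
     U \<bullet>\<^bsub>C\<^esub> ((T \<boxtimes>\<^bsub>C\<^esub> T) \<star>\<^bsub>C\<^esub> cid C \<beta>) = (cid C \<alpha> \<star>\<^bsub>C\<^esub> T) \<bullet>\<^bsub>C\<^esub> V)"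

text \<open>
  Arrows and 2-cells of the 2-category of units are tagged with their boundary, since the same
  pair \<open>(u, U)\<close>, or the same 2-cell \<open>T\<close>, may occur with different boundaries. The composite of
  \<open>(u, U)\<close> and \<open>(v, V)\<close> is \<open>u \<sharp> v\<close> with the pasting of \<open>U\<close> and \<open>V\<close>, using the strict
  interchange \<open>(u \<otimes> u) \<sharp> (v \<otimes> v) = (u \<sharp> v) \<otimes> (u \<sharp> v)\<close>.
\<close>

definition unit_2cat ::
  "('o, 'a, 'c, 'm) semi_mon_2cat_scheme \<Rightarrow>
   ('o \<times> 'a,
    ('o \<times> 'a) \<times> ('o \<times> 'a) \<times> ('a \<times> 'c),
    ('o \<times> 'a) \<times> ('o \<times> 'a) \<times> ('a \<times> 'c) \<times> ('a \<times> 'c) \<times> 'c) two_cat" where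
  "unit_2cat C =
     \<lparr>Obj = {x. unit_object C x},
      Arr = {(x, y, p). unit_morphism C x y p},
      Cell = {(x, y, p, q, T). unit_2morphism C x y p q T},
      adom = (\<lambda>(x, y, p). x),
      acod = (\<lambda>(x, y, p). y),
      csrc = (\<lambda>(x, y, p, q, T). (x, y, p)),
      ctrg = (\<lambda>(x, y, p, q, T). (x, y, q)),
      aid = (\<lambda>(I, \<alpha>). ((I, \<alpha>), (I, \<alpha>), (aid C I, cid C \<alpha>))),
      cid = (\<lambda>(x, y, (u, U)). (x, y, (u, U), (u, U), cid C u)),
      acomp = (\<lambda>(x, y, (u, U)) (y', z, (v, V)).
        (x, z, (u \<sharp>\<^bsub>C\<^esub> v, (U \<star>\<^bsub>C\<^esub> cid C v) \<bullet>\<^bsub>C\<^esub> (cid C (u \<otimes>\<^bsub>C\<^esub> u) \<star>\<^bsub>C\<^esub> V)))),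
      hcomp = (\<lambda>(x, y, (u, U), (u', U'), S) (y', z, (v, V), (v', V'), T).
        (x, z,
         (u \<sharp>\<^bsub>C\<^esub> v, (U \<star>\<^bsub>C\<^esub> cid C v) \<bullet>\<^bsub>C\<^esub> (cid C (u \<otimes>\<^bsub>C\<^esub> u) \<star>\<^bsub>C\<^esub> V)),
         (u' \<sharp>\<^bsub>C\<^esub> v', (U' \<star>\<^bsub>C\<^esub> cid C v') \<bullet>\<^bsub>C\<^esub> (cid C (u' \<otimes>\<^bsub>C\<^esub> u') \<star>\<^bsub>C\<^esub> V')),
         S \<star>\<^bsub>C\<^esub> T)),
      vcomp = (\<lambda>(x, y, p, q, S) (x', y', q', r, T). (x, y, p, r, S \<bullet>\<^bsub>C\<^esub> T))\<rparr>"

end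

theory Submission
  imports Defs
begin

text \<open>
  Write \<open>f \<cong> g\<close> if there is an invertible 2-cell from \<open>f\<close> to \<open>g\<close>, and write an object for the
  identity arrow on it. Let \<open>(J, \<beta>)\<close> be a unit. Cancelling \<open>J\<close> on the left yields equi-arrows
  \<open>\<lambda>\<^sub>X : JX \<rightarrow> X\<close> with \<open>J\<lambda>\<^sub>X \<cong> \<beta>X\<close>. Comparing \<open>J\<lambda>\<^sub>J \<sharp> \<lambda>\<^sub>J\<close> with \<open>\<lambda>\<^sub>JJ \<sharp> \<lambda>\<^sub>J\<close> after tensoring with \<open>J\<close> shows
  \<open>J\<lambda>\<^sub>J \<cong> \<lambda>\<^sub>JJ\<close>, hence \<open>\<beta> \<cong> \<lambda>\<^sub>J\<close> and \<open>J\<beta> \<cong> \<beta>J\<close>. Put \<open>\<mu> = \<lambda>\<^sub>I\<close>. The latter 2-cell and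
  \<open>J\<mu> \<cong> \<beta>I\<close> combine, after cancelling \<open>J\<close>, to invertible 2-cells \<open>N\<^sub>u : Ju \<sharp> \<beta> \<Rightarrow> \<mu> \<sharp> u\<close>, natural in
  \<open>u : I \<rightarrow> J\<close>.

  Since \<open>uu \<sharp> \<beta> = uI \<sharp> Ju \<sharp> \<beta> \<cong> uI \<sharp> \<mu> \<sharp> u\<close>, a 2-cell \<open>U : \<alpha> \<sharp> u \<Rightarrow> uu \<sharp> \<beta>\<close> is the same as a 2-cell
  \<open>U' : \<alpha> \<Rightarrow> uI \<sharp> \<mu>\<close>. As \<open>\<mu>\<close> is an equi-arrow and \<open>I\<close> is cancellable on the right, some \<open>u\<close> admits an
  invertible \<open>U'\<close>. The equation of a unit 2-morphism \<open>T\<close> turns into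
  \<open>U' \<bullet> (TI \<sharp> \<mu>) = V'\<close>, which has exactly one solution for the same two reasons.
\<close>

section \<open>Equivalences of categories\<close>

lemma (in category) iso_arrow_epi:
  assumes "iso_arrow K e" "f \<in> Ar K" "g \<in> Ar K" "Dom K f = Cod K e" "Dom K g = Cod K e"
    and "Cmp K e f = Cmp K e g"
  shows "f = g"
proof -
  obtain d where e: "e \<in> Ar K" and d: "d \<in> Ar K" "Dom K d = Cod K e" "Cod K d = Dom K e"
    "Cmp K d e = Idt K (Cod K e)"
    using assms(1) by (auto simp: iso_arrow_def)
  have "Cmp K (Cmp K d e) f = Cmp K (Cmp K d e) g"
    using assms d(1-3) e by (simp add: Cmp_assoc)
  then show ?thesis
    using assms d by (metis Cmp_Idt_left)
qed

lemma (in category) iso_arrow_mono: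
  assumes "iso_arrow K e" "f \<in> Ar K" "g \<in> Ar K" "Cod K f = Dom K e" "Cod K g = Dom K e"
    and "Cmp K f e = Cmp K g e"
  shows "f = g"
proof -
  obtain d where e: "e \<in> Ar K" and d: "d \<in> Ar K" "Dom K d = Cod K e" "Cod K d = Dom K e"
    "Cmp K e d = Idt K (Dom K e)"
    using assms(1) by (auto simp: iso_arrow_def)
  have "Cmp K f (Cmp K e d) = Cmp K g (Cmp K e d)"
    using assms d(1-3) e by (simp flip: Cmp_assoc)
  then show ?thesis
    using assms d by (metis Cmp_Idt_right)
qed

text \<open>By naturality, \<open>f\<close> followed by the isomorphism
  \<open>\<eta> (Cod K f)\<close> depends only on \<open>F1 f\<close> and the endpoints, and
  isomorphisms can be cancelled.\<close>

lemma cat_equivalence_faithful: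
  assumes "cat_equivalence K L F0 F1" "f \<in> Ar K" "g \<in> Ar K"
    and "Dom K f = Dom K g" "Cod K f = Cod K g" "F1 f = F1 g"
  shows "f = g"
proof -
  obtain G0 G1 \<eta> where \<eta>: "natural_iso K K id id (G0 \<circ> F0) (G1 \<circ> F1) \<eta>"
    using assms(1) by (auto simp: cat_equivalence_def)
  interpret F: cat_functor K L F0 F1
    using assms(1) by (simp add: cat_equivalence_def)
  have nat: "Cmp K h (\<eta> (Cod K h)) = Cmp K (\<eta> (Dom K h)) (G1 (F1 h))" if "h \<in> Ar K" for h
    using \<eta> that by (simp add: natural_iso_def)
  have "Cmp K f (\<eta> (Cod K f)) = Cmp K g (\<eta> (Cod K f))"
    using nat[OF assms(2)] nat[OF assms(3)] assms(4-6) by simp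
  moreover have "iso_arrow K (\<eta> (Cod K f))" "Dom K (\<eta> (Cod K f)) = Cod K f"
    using \<eta> F.K.Cod_closed[OF assms(2)] by (auto simp: natural_iso_def)
  ultimately show ?thesis
    using F.K.iso_arrow_mono assms(2,3,5) by metis
qed

text \<open>The preimage is \<open>G1 h\<close> conjugated with components of \<open>\<eta>\<close>.
  Naturality of \<open>\<eta>\<close> then yields only \<open>G1 h = G1 (F1 f)\<close>; to reach
  \<open>F1 f = h\<close> one uses that \<open>G1\<close> is faithful, which comes from
  \<open>\<epsilon>\<close>.\<close>

lemma cat_equivalence_full:
  assumes "cat_equivalence K L F0 F1" "x \<in> Ob K" "y \<in> Ob K" "h \<in> Ar L"
    and "Dom L h = F0 x" "Cod L h = F0 y"
  shows "\<exists>f \<in> Ar K. Dom K f = x \<and> Cod K f = y \<and> F1 f = h"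
proof -
  obtain G0 G1 \<eta> \<epsilon> where G: "cat_functor L K G0 G1"
    and \<eta>: "natural_iso K K id id (G0 \<circ> F0) (G1 \<circ> F1) \<eta>"
    and \<epsilon>: "natural_iso L L (F0 \<circ> G0) (F1 \<circ> G1) id id \<epsilon>"
    using assms(1) by (auto simp: cat_equivalence_def)
  interpret F: cat_functor K L F0 F1
    using assms(1) by (simp add: cat_equivalence_def)
  interpret G: cat_functor L K G0 G1 by (fact G)
  have \<eta>x: "\<eta> z \<in> Ar K" "Dom K (\<eta> z) = z" "Cod K (\<eta> z) = G0 (F0 z)" "iso_arrow K (\<eta> z)"
    if "z \<in> Ob K" for z
    using \<eta> that unfolding natural_iso_def by (auto simp: iso_arrow_def[of K "\<eta> z"])
  obtain d where d: "d \<in> Ar K" "Dom K d = G0 (F0 y)" "Cod K d = y"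
    "Cmp K d (\<eta> y) = Idt K (G0 (F0 y))"
    using \<eta>x[OF assms(3)] by (auto simp: iso_arrow_def)
  define f where "f = Cmp K (\<eta> x) (Cmp K (G1 h) d)"
  have Gh: "G1 h \<in> Ar K" "Dom K (G1 h) = G0 (F0 x)" "Cod K (G1 h) = G0 (F0 y)"
    using assms G.F1_closed G.F1_Dom G.F1_Cod by auto
  have f: "f \<in> Ar K" "Dom K f = x" "Cod K f = y"
    unfolding f_def using \<eta>x assms Gh d
    by (simp_all add: F.K.Cmp_closed F.K.Dom_Cmp F.K.Cod_Cmp)
  have "Cmp K f (\<eta> y) = Cmp K (\<eta> x) (Cmp K (G1 h) (Cmp K d (\<eta> y)))"
    unfolding f_def using \<eta>x assms Gh d
    by (simp add: F.K.Cmp_closed F.K.Dom_Cmp F.K.Cod_Cmp F.K.Cmp_assoc)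
  also have "\<dots> = Cmp K (\<eta> x) (G1 h)"
    using d Gh F.K.Cmp_Idt_right by metis
  finally have 1: "Cmp K f (\<eta> y) = Cmp K (\<eta> x) (G1 h)" .
  have "Cmp K f (\<eta> y) = Cmp K (\<eta> x) (G1 (F1 f))"
    using \<eta> f by (auto simp: natural_iso_def)
  with 1 have eq: "Cmp K (\<eta> x) (G1 h) = Cmp K (\<eta> x) (G1 (F1 f))" by simp
  have GF: "G1 h = G1 (F1 f)"
  proof (rule F.K.iso_arrow_epi[OF \<eta>x(4)[OF assms(2)] _ _ _ _ eq])
    show "G1 h \<in> Ar K" "G1 (F1 f) \<in> Ar K" "Dom K (G1 h) = Cod K (\<eta> x)"
      "Dom K (G1 (F1 f)) = Cod K (\<eta> x)"
      using \<eta>x assms Gh f by (simp_all add: G.F1_closed F.F1_closed G.F1_Dom F.F1_Dom)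
  qed
  have Ff: "F1 f \<in> Ar L" "Dom L (F1 f) = F0 x" "Cod L (F1 f) = F0 y"
    using f F.F1_closed F.F1_Dom F.F1_Cod by auto
  \<comment> \<open>Faithfulness of \<open>G1\<close>: by naturality both sides equal
    \<open>F1\<close> of the common arrow \<open>G1 h = G1 (F1 f)\<close>, followed by
    \<open>\<epsilon> (F0 y)\<close>.\<close>
  have "Cmp L (\<epsilon> (F0 x)) h = Cmp L (\<epsilon> (F0 x)) (F1 f)"
  proof -
    have "Cmp L (\<epsilon> (Dom L k)) k = Cmp L (F1 (G1 k)) (\<epsilon> (Cod L k))" if "k \<in> Ar L" for k
      using \<epsilon> that by (auto simp: natural_iso_def)
    from this[OF assms(4)] this[OF Ff(1)] show ?thesis
      using assms Ff GF by simp
  qed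
  moreover have "iso_arrow L (\<epsilon> (F0 x))" "Cod L (\<epsilon> (F0 x)) = F0 x"
    using \<epsilon> F.F0_closed[OF assms(2)] by (auto simp: natural_iso_def)
  ultimately have "F1 f = h"
    using F.L.iso_arrow_epi assms(4,5) Ff by metis
  with f show ?thesis by auto
qed

lemma cat_equivalence_ess_surj:
  assumes "cat_equivalence K L F0 F1" "y \<in> Ob L"
  shows "\<exists>x \<in> Ob K. \<exists>e. iso_arrow L e \<and> Dom L e = F0 x \<and> Cod L e = y"
proof -
  obtain G0 G1 \<epsilon> where "cat_functor L K G0 G1"
    "natural_iso L L (F0 \<circ> G0) (F1 \<circ> G1) id id \<epsilon>"
    using assms(1) by (auto simp: cat_equivalence_def)
  with assms(2) show ?thesis
    by (intro bexI[of _ "G0 y"] exI[of _ "\<epsilon> y"])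
       (auto simp: natural_iso_def cat_functor_def cat_functor_axioms_def)
qed


section \<open>Isomorphism of arrows and equi-arrows\<close>

definition cell_iso :: "('o, 'a, 'c, 'm) two_cat_scheme \<Rightarrow> 'a \<Rightarrow> 'a \<Rightarrow> bool" where
  "cell_iso C f g \<longleftrightarrow> (\<exists>T. invertible_cell C T \<and> cell_in C T f g)"

text \<open>The choice is harmless, since a vertical inverse is unique whenever it exists.\<close>

definition vinv :: "('o, 'a, 'c, 'm) two_cat_scheme \<Rightarrow> 'c \<Rightarrow> 'c" where
  "vinv C T = (SOME S. cell_in C S (ctrg C T) (csrc C T) \<and>
     T \<bullet>\<^bsub>C\<^esub> S = cid C (csrc C T) \<and> S \<bullet>\<^bsub>C\<^esub> T = cid C (ctrg C T))"

context strict_2category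
begin

lemma arrow_simps [simp]:
  "X \<in> Obj C \<Longrightarrow> aid C X \<in> Arr C"
  "X \<in> Obj C \<Longrightarrow> adom C (aid C X) = X"
  "X \<in> Obj C \<Longrightarrow> acod C (aid C X) = X"
  "\<lbrakk>f \<in> Arr C; g \<in> Arr C; acod C f = adom C g\<rbrakk> \<Longrightarrow> f \<sharp> g \<in> Arr C"
  "\<lbrakk>f \<in> Arr C; g \<in> Arr C; acod C f = adom C g\<rbrakk> \<Longrightarrow> adom C (f \<sharp> g) = adom C f"
  "\<lbrakk>f \<in> Arr C; g \<in> Arr C; acod C f = adom C g\<rbrakk> \<Longrightarrow> acod C (f \<sharp> g) = acod C g"
  using aid_in acomp_in by (auto simp: arr_in_def)

lemma cell_simps [simp]:
  "f \<in> Arr C \<Longrightarrow> cid C f \<in> Cell C"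
  "f \<in> Arr C \<Longrightarrow> csrc C (cid C f) = f"
  "f \<in> Arr C \<Longrightarrow> ctrg C (cid C f) = f"
  "\<lbrakk>S \<in> Cell C; T \<in> Cell C; ctrg C S = csrc C T\<rbrakk> \<Longrightarrow> S \<bullet> T \<in> Cell C"
  "\<lbrakk>S \<in> Cell C; T \<in> Cell C; ctrg C S = csrc C T\<rbrakk> \<Longrightarrow> csrc C (S \<bullet> T) = csrc C S"
  "\<lbrakk>S \<in> Cell C; T \<in> Cell C; ctrg C S = csrc C T\<rbrakk> \<Longrightarrow> ctrg C (S \<bullet> T) = ctrg C T"
  "\<lbrakk>S \<in> Cell C; T \<in> Cell C; acod C (csrc C S) = adom C (csrc C T)\<rbrakk> \<Longrightarrow> S \<star> T \<in> Cell C"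
  "\<lbrakk>S \<in> Cell C; T \<in> Cell C; acod C (csrc C S) = adom C (csrc C T)\<rbrakk>
    \<Longrightarrow> csrc C (S \<star> T) = csrc C S \<sharp> csrc C T"
  "\<lbrakk>S \<in> Cell C; T \<in> Cell C; acod C (csrc C S) = adom C (csrc C T)\<rbrakk>
    \<Longrightarrow> ctrg C (S \<star> T) = ctrg C S \<sharp> ctrg C T"
  using cid_in vcomp_in hcomp_in by (auto simp: cell_in_def)

declare adom_closed [simp] acod_closed [simp] csrc_closed [simp] ctrg_closed [simp]
  parallel_dom [simp] parallel_cod [simp]
  acomp_aid_left [simp] acomp_aid_right [simp]
  vcomp_cid_left [simp] vcomp_cid_right [simp]
  hcomp_aid_left [simp] hcomp_aid_right [simp]

text \<open>The unprimed rules match only identities on the literal term \<open>csrc C T\<close> or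
  \<open>ctrg C T\<close>; these variants, and the two lemmas after them, also apply when the
  boundary is known under another name.\<close>

lemma vcomp_cid_left' [simp]: "\<lbrakk>T \<in> Cell C; csrc C T = f\<rbrakk> \<Longrightarrow> cid C f \<bullet> T = T"
  and vcomp_cid_right' [simp]: "\<lbrakk>T \<in> Cell C; ctrg C T = f\<rbrakk> \<Longrightarrow> T \<bullet> cid C f = T"
  by auto

lemma acomp_aid_left' [simp]: "\<lbrakk>f \<in> Arr C; adom C f = X\<rbrakk> \<Longrightarrow> aid C X \<sharp> f = f"
  and acomp_aid_right' [simp]: "\<lbrakk>f \<in> Arr C; acod C f = X\<rbrakk> \<Longrightarrow> f \<sharp> aid C X = f"
  by auto

lemma hcomp_aid_left' [simp]: "\<lbrakk>T \<in> Cell C; adom C (csrc C T) = X\<rbrakk> \<Longrightarrow> cid C (aid C X) \<star> T = T"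
  and hcomp_aid_right' [simp]: "\<lbrakk>T \<in> Cell C; acod C (csrc C T) = X\<rbrakk> \<Longrightarrow> T \<star> cid C (aid C X) = T"
  by auto

lemma cell_in_arr:
  assumes "cell_in C T f g"
  shows "f \<in> Arr C" "g \<in> Arr C" "adom C g = adom C f" "acod C g = acod C f"
  using assms by (auto simp: cell_in_def)

text \<open>Interchange after padding both cells with identities. Equating this factorization with
  the mirror one below is the source of the naturality squares used later.\<close>

lemma hcomp_eq_left_right:
  assumes "S \<in> Cell C" "T \<in> Cell C" "acod C (csrc C S) = adom C (csrc C T)"
  shows "S \<star> T = (S \<star> cid C (csrc C T)) \<bullet> (cid C (ctrg C S) \<star> T)"
  using assms by (simp flip: interchange)

lemma hcomp_eq_right_left:
  assumes "S \<in> Cell C" "T \<in> Cell C" "acod C (csrc C S) = adom C (csrc C T)"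
  shows "S \<star> T = (cid C (csrc C S) \<star> T) \<bullet> (S \<star> cid C (ctrg C T))"
  using assms by (simp flip: interchange)

section \<open>Invertible 2-cells\<close>

lemma vinv:
  assumes "invertible_cell C T"
  shows "vinv C T \<in> Cell C" "csrc C (vinv C T) = ctrg C T" "ctrg C (vinv C T) = csrc C T"
    and "T \<bullet> vinv C T = cid C (csrc C T)" "vinv C T \<bullet> T = cid C (ctrg C T)"
proof -
  have "\<exists>S. cell_in C S (ctrg C T) (csrc C T) \<and>
     T \<bullet> S = cid C (csrc C T) \<and> S \<bullet> T = cid C (ctrg C T)"
    using assms by (auto simp: invertible_cell_def)
  from someI_ex[OF this]
  show "vinv C T \<in> Cell C" "csrc C (vinv C T) = ctrg C T" "ctrg C (vinv C T) = csrc C T"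
    and "T \<bullet> vinv C T = cid C (csrc C T)" "vinv C T \<bullet> T = cid C (ctrg C T)"
    unfolding vinv_def[symmetric] by (simp_all add: cell_in_def)
qed

lemma invertible_cell_in_Cell: "invertible_cell C T \<Longrightarrow> T \<in> Cell C"
  by (simp add: invertible_cell_def)

lemma invertible_cellI:
  assumes "T \<in> Cell C" "S \<in> Cell C" "csrc C S = ctrg C T" "ctrg C S = csrc C T"
    "T \<bullet> S = cid C (csrc C T)" "S \<bullet> T = cid C (ctrg C T)"
  shows "invertible_cell C T"
  using assms by (auto simp: invertible_cell_def cell_in_def)

lemma invertible_vinv: "invertible_cell C T \<Longrightarrow> invertible_cell C (vinv C T)"
  using vinv by (intro invertible_cellI[of _ T]) (auto simp: invertible_cell_in_Cell)

lemma invertible_cid: "f \<in> Arr C \<Longrightarrow> invertible_cell C (cid C f)"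
  by (intro invertible_cellI[of _ "cid C f"]) auto

lemma invertible_vcomp:
  assumes "invertible_cell C S" "invertible_cell C T" "ctrg C S = csrc C T"
  shows "invertible_cell C (S \<bullet> T)"
proof -
  note ty = vinv(1-3)[OF assms(1)] vinv(1-3)[OF assms(2)] assms(3)
    invertible_cell_in_Cell[OF assms(1)] invertible_cell_in_Cell[OF assms(2)]
  have "(S \<bullet> T) \<bullet> (vinv C T \<bullet> vinv C S) = S \<bullet> ((T \<bullet> vinv C T) \<bullet> vinv C S)"
    using ty by (simp add: vcomp_assoc)
  also have "\<dots> = cid C (csrc C S)"
    using ty vinv(4)[OF assms(1)] vinv(4)[OF assms(2)] by simp
  finally have 1: "(S \<bullet> T) \<bullet> (vinv C T \<bullet> vinv C S) = cid C (csrc C S)" .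
  have "(vinv C T \<bullet> vinv C S) \<bullet> (S \<bullet> T) = vinv C T \<bullet> ((vinv C S \<bullet> S) \<bullet> T)"
    using ty by (simp add: vcomp_assoc)
  also have "\<dots> = cid C (ctrg C T)"
    using ty vinv(5)[OF assms(1)] vinv(5)[OF assms(2)] by simp
  finally have 2: "(vinv C T \<bullet> vinv C S) \<bullet> (S \<bullet> T) = cid C (ctrg C T)" .
  show ?thesis
    using ty 1 2 by (intro invertible_cellI[of _ "vinv C T \<bullet> vinv C S"]) simp_all
qed

lemma invertible_hcomp:
  assumes "invertible_cell C S" "invertible_cell C T" "acod C (csrc C S) = adom C (csrc C T)"
  shows "invertible_cell C (S \<star> T)"
proof -
  note [simp] = vinv[OF assms(1)] vinv[OF assms(2)] assms(3)
    invertible_cell_in_Cell[OF assms(1)] invertible_cell_in_Cell[OF assms(2)]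
  show ?thesis
    by (intro invertible_cellI[of _ "vinv C S \<star> vinv C T"])
       (simp_all add: hcomp_cid flip: interchange)
qed

lemma vcomp_left_cancel:
  assumes "invertible_cell C R" "S \<in> Cell C" "T \<in> Cell C" "csrc C S = ctrg C R" "csrc C T = ctrg C R"
    and "R \<bullet> S = R \<bullet> T"
  shows "S = T"
proof -
  have "(vinv C R \<bullet> R) \<bullet> S = (vinv C R \<bullet> R) \<bullet> T"
    using assms vinv(1-3)[OF assms(1)] invertible_cell_in_Cell[OF assms(1)]
    by (simp add: vcomp_assoc)
  then show ?thesis using assms vinv(5)[OF assms(1)] by simp
qed

lemma vcomp_right_cancel:
  assumes "invertible_cell C R" "S \<in> Cell C" "T \<in> Cell C" "ctrg C S = csrc C R" "ctrg C T = csrc C R"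
    and "S \<bullet> R = T \<bullet> R"
  shows "S = T"
proof -
  have "S \<bullet> (R \<bullet> vinv C R) = T \<bullet> (R \<bullet> vinv C R)"
    using assms vinv(1-3)[OF assms(1)] invertible_cell_in_Cell[OF assms(1)]
    by (simp flip: vcomp_assoc)
  then show ?thesis using assms vinv(4)[OF assms(1)] by simp
qed

section \<open>Isomorphism of arrows as a congruence\<close>

lemma cell_iso_arr:
  assumes "cell_iso C f g"
  shows "f \<in> Arr C" "g \<in> Arr C" "adom C g = adom C f" "acod C g = acod C f"
  using assms cell_in_arr by (auto simp: cell_iso_def)

lemma cell_iso_refl: "f \<in> Arr C \<Longrightarrow> cell_iso C f f"
  using invertible_cid cid_in by (auto simp: cell_iso_def)

lemma cell_iso_sym: "cell_iso C f g \<Longrightarrow> cell_iso C g f"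
  unfolding cell_iso_def cell_in_def using invertible_vinv vinv by blast

lemma cell_iso_trans [trans]:
  assumes "cell_iso C f g" "cell_iso C g h"
  shows "cell_iso C f h"
proof -
  obtain S T where "invertible_cell C S" "cell_in C S f g" "invertible_cell C T" "cell_in C T g h"
    using assms by (auto simp: cell_iso_def)
  then show ?thesis
    using invertible_vcomp[of S T] vcomp_in[of S T]
    unfolding cell_iso_def by (intro exI[of _ "S \<bullet> T"]) (auto simp: cell_in_def)
qed

lemma cell_iso_acomp:
  assumes "cell_iso C f f'" "cell_iso C g g'" "acod C f = adom C g"
  shows "cell_iso C (f \<sharp> g) (f' \<sharp> g')"
proof -
  obtain S T where "invertible_cell C S" "cell_in C S f f'" "invertible_cell C T" "cell_in C T g g'"
    using assms by (auto simp: cell_iso_def)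
  then show ?thesis
    using invertible_hcomp[of S T] hcomp_in[of S T] assms(3)
    unfolding cell_iso_def by (intro exI[of _ "S \<star> T"]) (auto simp: cell_in_def)
qed

section \<open>Stability of equi-arrows\<close>

lemma equi_arrow_altdef:
  "equi_arrow C f \<longleftrightarrow> f \<in> Arr C \<and> (\<exists>g. arr_in C g (acod C f) (adom C f) \<and>
     cell_iso C (f \<sharp> g) (aid C (adom C f)) \<and> cell_iso C (g \<sharp> f) (aid C (acod C f)))"
  by (auto simp: equi_arrow_def cell_iso_def)

lemma equi_arrowI:
  assumes "f \<in> Arr C" "g \<in> Arr C" "adom C g = acod C f" "acod C g = adom C f"
    "cell_iso C (f \<sharp> g) (aid C (adom C f))" "cell_iso C (g \<sharp> f) (aid C (acod C f))"
  shows "equi_arrow C f"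
  using assms by (auto simp: equi_arrow_altdef arr_in_def)

lemma equi_arrowE:
  assumes "equi_arrow C f"
  obtains g where "f \<in> Arr C" "g \<in> Arr C" "adom C g = acod C f" "acod C g = adom C f"
    "cell_iso C (f \<sharp> g) (aid C (adom C f))" "cell_iso C (g \<sharp> f) (aid C (acod C f))"
    "equi_arrow C g"
proof -
  obtain g where g: "f \<in> Arr C" "g \<in> Arr C" "adom C g = acod C f" "acod C g = adom C f"
    "cell_iso C (f \<sharp> g) (aid C (adom C f))" "cell_iso C (g \<sharp> f) (aid C (acod C f))"
    using assms by (auto simp: equi_arrow_altdef arr_in_def)
  moreover have "equi_arrow C g"
    using g by (intro equi_arrowI[of g f]) auto
  ultimately show thesis by (rule that)
qed

lemma equi_arrow_cell_iso:
  assumes "equi_arrow C f" "cell_iso C f g"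
  shows "equi_arrow C g"
proof -
  obtain h where h: "f \<in> Arr C" "h \<in> Arr C" "adom C h = acod C f" "acod C h = adom C f"
    "cell_iso C (f \<sharp> h) (aid C (adom C f))" "cell_iso C (h \<sharp> f) (aid C (acod C f))"
    using assms(1) by (rule equi_arrowE)
  note g = cell_iso_arr[OF assms(2)]
  have "cell_iso C (g \<sharp> h) (f \<sharp> h)" "cell_iso C (h \<sharp> g) (h \<sharp> f)"
    using h g assms(2) by (auto intro!: cell_iso_acomp intro: cell_iso_refl cell_iso_sym)
  with h g show ?thesis
    by (intro equi_arrowI[of g h]) (auto intro: cell_iso_trans)
qed

lemma equi_arrow_acomp:
  assumes "equi_arrow C f" "equi_arrow C g" "acod C f = adom C g"
  shows "equi_arrow C (f \<sharp> g)"
proof -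
  obtain f' where f: "f \<in> Arr C" "f' \<in> Arr C" "adom C f' = acod C f" "acod C f' = adom C f"
    "cell_iso C (f \<sharp> f') (aid C (adom C f))" "cell_iso C (f' \<sharp> f) (aid C (acod C f))"
    using assms(1) by (rule equi_arrowE)
  obtain g' where g: "g \<in> Arr C" "g' \<in> Arr C" "adom C g' = acod C g" "acod C g' = adom C g"
    "cell_iso C (g \<sharp> g') (aid C (adom C g))" "cell_iso C (g' \<sharp> g) (aid C (acod C g))"
    using assms(2) by (rule equi_arrowE)
  have "cell_iso C (f \<sharp> ((g \<sharp> g') \<sharp> f')) (f \<sharp> (aid C (adom C g) \<sharp> f'))"
    using f g assms(3) by (intro cell_iso_acomp cell_iso_refl) auto
  then have 1: "cell_iso C ((f \<sharp> g) \<sharp> (g' \<sharp> f')) (f \<sharp> f')"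
    using f g assms(3) by (simp add: acomp_assoc)
  have "cell_iso C (g' \<sharp> ((f' \<sharp> f) \<sharp> g)) (g' \<sharp> (aid C (adom C g) \<sharp> g))"
    using f g assms(3) by (intro cell_iso_acomp cell_iso_refl) auto
  then have 2: "cell_iso C ((g' \<sharp> f') \<sharp> (f \<sharp> g)) (g' \<sharp> g)"
    using f g assms(3) by (simp add: acomp_assoc)
  show ?thesis
    using f g assms(3) cell_iso_trans[OF 1 f(5)] cell_iso_trans[OF 2 g(6)]
    by (intro equi_arrowI[of _ "g' \<sharp> f'"]) auto
qed

text \<open>Whisker once more with a pseudo-inverse \<open>d\<close> of \<open>e\<close>. The
  invertible cell \<open>\<theta>\<close> from \<open>e \<sharp> d\<close> to the identity makes the
  doubly whiskered cell a conjugate of the original one, which can thus be recovered.\<close>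

lemma whisker_equi_faithful:
  assumes "equi_arrow C e" and ST: "S \<in> Cell C" "T \<in> Cell C" "csrc C S = csrc C T" "ctrg C S = ctrg C T"
    and "acod C (csrc C S) = adom C e" and eq: "S \<star> cid C e = T \<star> cid C e"
  shows "S = T"
proof -
  define f g where "f = csrc C S" and "g = ctrg C S"
  then have S: "cell_in C S f g" and T: "cell_in C T f g" and fe: "acod C f = adom C e"
    using assms by (auto simp: cell_in_def)
  obtain d where d: "e \<in> Arr C" "d \<in> Arr C" "adom C d = acod C e" "acod C d = adom C e"
    "cell_iso C (e \<sharp> d) (aid C (adom C e))"
    using assms(1) by (rule equi_arrowE)
  obtain \<theta> where \<theta>: "invertible_cell C \<theta>" "\<theta> \<in> Cell C" "csrc C \<theta> = e \<sharp> d"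
    "ctrg C \<theta> = aid C (adom C e)"
    using d(5) by (auto simp: cell_iso_def cell_in_def)
  have *: "R \<star> cid C (e \<sharp> d) = (R \<star> cid C e) \<star> cid C d"
    and nat: "(R \<star> cid C (e \<sharp> d)) \<bullet> (cid C g \<star> \<theta>) = (cid C f \<star> \<theta>) \<bullet> R" if "cell_in C R f g" for R
  proof -
    have R: "R \<in> Cell C" "csrc C R = f" "ctrg C R = g" "f \<in> Arr C" "g \<in> Arr C"
      using that by (auto simp: cell_in_def)
    then show "R \<star> cid C (e \<sharp> d) = (R \<star> cid C e) \<star> cid C d"
      using d fe by (simp add: hcomp_assoc hcomp_cid)
    have "acod C (csrc C R) = adom C (csrc C \<theta>)"
      using R \<theta> d fe by simp
    from hcomp_eq_left_right[OF R(1) \<theta>(2) this] hcomp_eq_right_left[OF R(1) \<theta>(2) this]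
    show "(R \<star> cid C (e \<sharp> d)) \<bullet> (cid C g \<star> \<theta>) = (cid C f \<star> \<theta>) \<bullet> R"
      using R \<theta> d fe by simp
  qed
  have fg: "f \<in> Arr C" "acod C f = adom C e"
    using S fe cell_in_arr by auto
  have inv: "invertible_cell C (cid C f \<star> \<theta>)"
    using \<theta> fg d by (intro invertible_hcomp invertible_cid) auto
  have "(cid C f \<star> \<theta>) \<bullet> S = (cid C f \<star> \<theta>) \<bullet> T"
    using *[OF S] *[OF T] nat[OF S] nat[OF T] eq by metis
  then show ?thesis
    using S T \<theta> fg d unfolding cell_in_def
    by - (rule vcomp_left_cancel[OF inv]; simp)
qed

text \<open>Whiskering \<open>R\<close> with a pseudo-inverse \<open>d\<close> and conjugating with
  \<open>\<theta>\<close> gives a candidate \<open>S\<close>. By construction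
  \<open>S \<star> cid C e\<close> and \<open>R\<close> agree after whiskering with
  \<open>d\<close>, and \<open>d\<close> is an equi-arrow, so faithfulness removes it.\<close>

lemma whisker_equi_full:
  assumes "equi_arrow C e" "f \<in> Arr C" "g \<in> Arr C" "adom C f = adom C g"
    "acod C f = adom C e" "acod C g = adom C e"
    and R: "cell_in C R (f \<sharp> e) (g \<sharp> e)"
  shows "\<exists>S. cell_in C S f g \<and> S \<star> cid C e = R"
proof -
  obtain d where d: "e \<in> Arr C" "d \<in> Arr C" "adom C d = acod C e" "acod C d = adom C e"
    "cell_iso C (e \<sharp> d) (aid C (adom C e))" "equi_arrow C d"
    using assms(1) by (rule equi_arrowE)
  obtain \<theta> where \<theta>: "invertible_cell C \<theta>" "\<theta> \<in> Cell C" "csrc C \<theta> = e \<sharp> d"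
    "ctrg C \<theta> = aid C (adom C e)"
    using d(5) by (auto simp: cell_iso_def cell_in_def)
  have R': "R \<in> Cell C" "csrc C R = f \<sharp> e" "ctrg C R = g \<sharp> e"
    using R by (auto simp: cell_in_def)
  have invf: "invertible_cell C (cid C f \<star> \<theta>)" and invg: "invertible_cell C (cid C g \<star> \<theta>)"
    using \<theta> d assms by (auto intro!: invertible_hcomp invertible_cid)
  note vi = vinv[OF invf]
  \<comment> \<open>The only \<open>S\<close> that makes the naturality square of
    \<open>\<theta>\<close> commute with \<open>R \<star> cid C d\<close> in place of
    \<open>S \<star> cid C (e \<sharp> d)\<close>.\<close>
  define S where "S = vinv C (cid C f \<star> \<theta>) \<bullet> ((R \<star> cid C d) \<bullet> (cid C g \<star> \<theta>))"
  have S: "S \<in> Cell C" "csrc C S = f" "ctrg C S = g"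
    unfolding S_def using vi R' \<theta> d assms by (simp_all add: acomp_assoc)
  have "(cid C f \<star> \<theta>) \<bullet> S
      = ((cid C f \<star> \<theta>) \<bullet> vinv C (cid C f \<star> \<theta>)) \<bullet> ((R \<star> cid C d) \<bullet> (cid C g \<star> \<theta>))"
    unfolding S_def using vi(1-3) R' \<theta> d assms by (simp add: acomp_assoc vcomp_assoc)
  also have "\<dots> = (R \<star> cid C d) \<bullet> (cid C g \<star> \<theta>)"
    using vi R' \<theta> d assms by (simp add: acomp_assoc)
  finally have 1: "(cid C f \<star> \<theta>) \<bullet> S = (R \<star> cid C d) \<bullet> (cid C g \<star> \<theta>)" .
  have "acod C (csrc C S) = adom C (csrc C \<theta>)"
    using S \<theta> d assms by simp
  from hcomp_eq_left_right[OF S(1) \<theta>(2) this] hcomp_eq_right_left[OF S(1) \<theta>(2) this]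
  have "(S \<star> cid C (e \<sharp> d)) \<bullet> (cid C g \<star> \<theta>) = (cid C f \<star> \<theta>) \<bullet> S"
    using S \<theta> d assms by simp
  with 1 have "S \<star> cid C (e \<sharp> d) = R \<star> cid C d"
    using S \<theta> d assms R' by - (rule vcomp_right_cancel[OF invg]; simp add: acomp_assoc)
  then have "(S \<star> cid C e) \<star> cid C d = R \<star> cid C d"
    using S d assms by (simp add: hcomp_assoc hcomp_cid)
  then have "S \<star> cid C e = R"
    using S d assms R' by - (rule whisker_equi_faithful[OF d(6)]; simp)
  with S show ?thesis by (auto simp: cell_in_def)
qed

text \<open>Fullness lifts the inverse of the whiskered cell; faithfulness turns the two lifted
  composites into identities.\<close>

lemma whisker_equi_reflects_invertible:
  assumes "equi_arrow C e" "cell_in C S f g" "acod C f = adom C e"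
    and "invertible_cell C (S \<star> cid C e)"
  shows "invertible_cell C S"
proof -
  have S: "S \<in> Cell C" "csrc C S = f" "ctrg C S = g" "f \<in> Arr C" "g \<in> Arr C"
    "adom C g = adom C f" "acod C g = acod C f"
    using assms(2) cell_in_arr by (auto simp: cell_in_def)
  have e: "e \<in> Arr C"
    using assms(1) by (simp add: equi_arrow_def)
  note vi = vinv[OF assms(4)]
  obtain R where R: "cell_in C R g f" "R \<star> cid C e = vinv C (S \<star> cid C e)"
    using whisker_equi_full[OF assms(1), of g f "vinv C (S \<star> cid C e)"] vi S assms(3) e
    by (auto simp: cell_in_def)
  have R': "R \<in> Cell C" "csrc C R = g" "ctrg C R = f"
    using R(1) by (auto simp: cell_in_def)
  \<comment> \<open>The identity of \<open>e\<close> is doubled so that interchange applies; the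
    rules that would collapse it again are switched off in the next step.\<close>
  have "(S \<bullet> R) \<star> cid C e = (S \<bullet> R) \<star> (cid C e \<bullet> cid C e)"
    using e by simp
  also have "\<dots> = cid C f \<star> cid C e"
    using S R' e assms(3) vi R(2) by (simp add: interchange hcomp_cid del: vcomp_cid_left' vcomp_cid_right' vcomp_cid_left vcomp_cid_right)
  finally have 1: "S \<bullet> R = cid C f"
    using S R' assms(3) by - (rule whisker_equi_faithful[OF assms(1)]; simp)
  have "(R \<bullet> S) \<star> cid C e = (R \<bullet> S) \<star> (cid C e \<bullet> cid C e)"
    using e by simp
  also have "\<dots> = cid C g \<star> cid C e"
    using S R' e assms(3) vi R(2) by (simp add: interchange hcomp_cid del: vcomp_cid_left' vcomp_cid_right' vcomp_cid_left vcomp_cid_right)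
  finally have 2: "R \<bullet> S = cid C g"
    using S R' assms(3) by - (rule whisker_equi_faithful[OF assms(1)]; simp)
  show ?thesis
    using S R' 1 2 by (intro invertible_cellI[of S R]) auto
qed

lemma cell_iso_acomp_equi_cancel:
  assumes "equi_arrow C e" "cell_iso C (f \<sharp> e) (g \<sharp> e)" "f \<in> Arr C" "g \<in> Arr C"
    "adom C f = adom C g" "acod C f = adom C e" "acod C g = adom C e"
  shows "cell_iso C f g"
proof -
  obtain R where R: "invertible_cell C R" "cell_in C R (f \<sharp> e) (g \<sharp> e)"
    using assms(2) by (auto simp: cell_iso_def)
  with whisker_equi_full[OF assms(1) assms(3-7)]
  obtain S where "cell_in C S f g" "S \<star> cid C e = R" by blast
  with R whisker_equi_reflects_invertible[OF assms(1)] assms show ?thesis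
    by (auto simp: cell_iso_def)
qed

end


section \<open>Fully faithful 2-functors\<close>

lemma hom_cat_simps [simp]:
  "Ob (hom_cat C X Y) = {f. arr_in C f X Y}"
  "Ar (hom_cat C X Y) = {T \<in> Cell C. arr_in C (csrc C T) X Y}"
  "Dom (hom_cat C X Y) = csrc C"
  "Cod (hom_cat C X Y) = ctrg C"
  "Idt (hom_cat C X Y) = cid C"
  "Cmp (hom_cat C X Y) = vcomp C"
  by (simp_all add: hom_cat_def)

context two_functor
begin

lemma map_simps [simp]:
  "f \<in> Arr C \<Longrightarrow> F1 f \<in> Arr D"
  "f \<in> Arr C \<Longrightarrow> adom D (F1 f) = F0 (adom C f)"
  "f \<in> Arr C \<Longrightarrow> acod D (F1 f) = F0 (acod C f)"
  "T \<in> Cell C \<Longrightarrow> F2 T \<in> Cell D"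
  "T \<in> Cell C \<Longrightarrow> csrc D (F2 T) = F1 (csrc C T)"
  "T \<in> Cell C \<Longrightarrow> ctrg D (F2 T) = F1 (ctrg C T)"
  using map_arr map_cell by (auto simp: arr_in_def cell_in_def)

end

context
  fixes C :: "('o, 'a, 'c, 'm) two_cat_scheme" and D :: "('o', 'a', 'c', 'm') two_cat_scheme"
    and F0 :: "'o \<Rightarrow> 'o'" and F1 :: "'a \<Rightarrow> 'a'" and F2 :: "'c \<Rightarrow> 'c'"
  assumes ff: "fully_faithful_2functor C D F0 F1 F2"
begin

interpretation F: two_functor C D F0 F1 F2
  using ff by (simp add: fully_faithful_2functor_def)

section \<open>What an equivalence on every hom category provides\<close>

lemma fully_faithful_hom_equivalence:
  assumes "X \<in> Obj C" "Y \<in> Obj C"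
  shows "cat_equivalence (hom_cat C X Y) (hom_cat D (F0 X) (F0 Y)) F1 F2"
  using ff assms by (simp add: fully_faithful_2functor_def)

lemma fully_faithful_faithful:
  assumes "S \<in> Cell C" "T \<in> Cell C" "csrc C S = csrc C T" "ctrg C S = ctrg C T" "F2 S = F2 T"
  shows "S = T"
  using assms
  by (intro cat_equivalence_faithful[OF fully_faithful_hom_equivalence
        [of "adom C (csrc C S)" "acod C (csrc C S)"], of S T])
     (simp_all add: arr_in_def)

lemma fully_faithful_full:
  assumes "f \<in> Arr C" "g \<in> Arr C" "adom C f = adom C g" "acod C f = acod C g"
    and "cell_in D R (F1 f) (F1 g)"
  shows "\<exists>T. cell_in C T f g \<and> F2 T = R"
proof -
  have "cat_equivalence (hom_cat C (adom C f) (acod C f))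
      (hom_cat D (F0 (adom C f)) (F0 (acod C f))) F1 F2"
    using assms by (intro fully_faithful_hom_equivalence) simp_all
  from cat_equivalence_full[OF this, of f g R] assms show ?thesis
    by (auto simp: arr_in_def cell_in_def)
qed

lemma fully_faithful_ess_surj:
  assumes "X \<in> Obj C" "Y \<in> Obj C" "arr_in D h (F0 X) (F0 Y)"
  shows "\<exists>f. arr_in C f X Y \<and> cell_iso D (F1 f) h"
proof -
  have "\<exists>f \<in> Ob (hom_cat C X Y). \<exists>e. iso_arrow (hom_cat D (F0 X) (F0 Y)) e \<and>
      Dom (hom_cat D (F0 X) (F0 Y)) e = F1 f \<and> Cod (hom_cat D (F0 X) (F0 Y)) e = h"
    using assms(3)
    by (intro cat_equivalence_ess_surj[OF fully_faithful_hom_equivalence[OF assms(1,2)]]) simp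
  then obtain f e where f: "arr_in C f X Y" and e: "iso_arrow (hom_cat D (F0 X) (F0 Y)) e"
    "csrc D e = F1 f" "ctrg D e = h"
    by auto
  from e(1) have "invertible_cell D e" "e \<in> Cell D"
    by (auto simp: iso_arrow_def intro: F.D.invertible_cellI)
  with e have "cell_iso D (F1 f) h"
    unfolding cell_iso_def by (intro exI[of _ e]) (simp add: cell_in_def)
  with f show ?thesis by blast
qed

text \<open>The same pattern as for whiskering: lift the inverse by fullness, then verify both
  inverse laws by faithfulness.\<close>

lemma fully_faithful_reflects_invertible:
  assumes T: "T \<in> Cell C" and inv: "invertible_cell D (F2 T)"
  shows "invertible_cell C T"
proof -
  note vi = F.D.vinv[OF inv]
  obtain S where "cell_in C S (ctrg C T) (csrc C T)" "F2 S = vinv D (F2 T)"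
    using fully_faithful_full[of "ctrg C T" "csrc C T" "vinv D (F2 T)"] vi T
    by (auto simp: cell_in_def)
  then have S: "S \<in> Cell C" "csrc C S = ctrg C T" "ctrg C S = csrc C T"
    "F2 S = vinv D (F2 T)"
    by (auto simp: cell_in_def)
  have "F2 (T \<bullet>\<^bsub>C\<^esub> S) = F2 (cid C (csrc C T))"
    using S T vi by (simp add: F.map_vcomp F.map_cid)
  then have 1: "T \<bullet>\<^bsub>C\<^esub> S = cid C (csrc C T)"
    using S T by - (rule fully_faithful_faithful; simp)
  have "F2 (S \<bullet>\<^bsub>C\<^esub> T) = F2 (cid C (ctrg C T))"
    using S T vi by (simp add: F.map_vcomp F.map_cid)
  then have 2: "S \<bullet>\<^bsub>C\<^esub> T = cid C (ctrg C T)"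
    using S T by - (rule fully_faithful_faithful; simp)
  show ?thesis
    using S T 1 2 by (intro F.C.invertible_cellI[of T S]) auto
qed

lemma fully_faithful_reflects_cell_iso:
  assumes "f \<in> Arr C" "g \<in> Arr C" "adom C f = adom C g" "acod C f = acod C g"
    and "cell_iso D (F1 f) (F1 g)"
  shows "cell_iso C f g"
proof -
  obtain R where "invertible_cell D R" "cell_in D R (F1 f) (F1 g)"
    using assms(5) by (auto simp: cell_iso_def)
  moreover from this fully_faithful_full[OF assms(1-4)]
  obtain T where "cell_in C T f g" "F2 T = R" by blast
  ultimately show ?thesis
    using fully_faithful_reflects_invertible by (auto simp: cell_iso_def cell_in_def)
qed

text \<open>A pseudo-inverse \<open>h\<close> of \<open>F1 f\<close> need not be in the image, but
  it is isomorphic to some \<open>F1 g\<close>. Then \<open>F1 g\<close> is again a pseudo-inverse,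
  and the isomorphisms witnessing this lift.\<close>

lemma fully_faithful_reflects_equi:
  assumes f: "f \<in> Arr C" and "equi_arrow D (F1 f)"
  shows "equi_arrow C f"
proof -
  obtain h where h: "h \<in> Arr D" "adom D h = F0 (acod C f)" "acod D h = F0 (adom C f)"
    "cell_iso D (F1 f \<sharp>\<^bsub>D\<^esub> h) (aid D (F0 (adom C f)))"
    "cell_iso D (h \<sharp>\<^bsub>D\<^esub> F1 f) (aid D (F0 (acod C f)))"
    using assms(2) by (rule F.D.equi_arrowE) (use f in auto)
  obtain g where g': "arr_in C g (acod C f) (adom C f)" and gh: "cell_iso D (F1 g) h"
    using fully_faithful_ess_surj[of "acod C f" "adom C f" h] f h by (auto simp: arr_in_def)
  have g: "g \<in> Arr C" "adom C g = acod C f" "acod C g = adom C f"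
    using g' by (auto simp: arr_in_def)
  have "cell_iso D (F1 f \<sharp>\<^bsub>D\<^esub> F1 g) (F1 f \<sharp>\<^bsub>D\<^esub> h)"
    "cell_iso D (F1 g \<sharp>\<^bsub>D\<^esub> F1 f) (h \<sharp>\<^bsub>D\<^esub> F1 f)"
    using f g gh by (auto intro!: F.D.cell_iso_acomp F.D.cell_iso_refl)
  with h(4,5) have "cell_iso D (F1 (f \<sharp>\<^bsub>C\<^esub> g)) (F1 (aid C (adom C f)))"
    "cell_iso D (F1 (g \<sharp>\<^bsub>C\<^esub> f)) (F1 (aid C (acod C f)))"
    using f g by (auto simp: F.map_acomp F.map_aid intro: F.D.cell_iso_trans)
  with f g have "cell_iso C (f \<sharp>\<^bsub>C\<^esub> g) (aid C (adom C f))"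
    "cell_iso C (g \<sharp>\<^bsub>C\<^esub> f) (aid C (acod C f))"
    by (auto intro!: fully_faithful_reflects_cell_iso)
  with f g show ?thesis
    by (intro F.C.equi_arrowI[of f g]) auto
qed

end


section \<open>Semi-monoidal 2-categories\<close>

context semi_monoidal_2category
begin

section \<open>Strict functoriality of the tensor product\<close>

interpretation tens: two_functor "prod_2cat C C" C
  "\<lambda>(X, Y). X \<odot> Y" "\<lambda>(f, g). f \<otimes> g" "\<lambda>(S, T). S \<boxtimes> T"
  by (fact tensor_2functor)

lemma tensor_simps [simp]:
  "\<lbrakk>X \<in> Obj C; Y \<in> Obj C\<rbrakk> \<Longrightarrow> X \<odot> Y \<in> Obj C"
  "\<lbrakk>f \<in> Arr C; g \<in> Arr C\<rbrakk> \<Longrightarrow> f \<otimes> g \<in> Arr C"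
  "\<lbrakk>f \<in> Arr C; g \<in> Arr C\<rbrakk> \<Longrightarrow> adom C (f \<otimes> g) = adom C f \<odot> adom C g"
  "\<lbrakk>f \<in> Arr C; g \<in> Arr C\<rbrakk> \<Longrightarrow> acod C (f \<otimes> g) = acod C f \<odot> acod C g"
  "\<lbrakk>S \<in> Cell C; T \<in> Cell C\<rbrakk> \<Longrightarrow> S \<boxtimes> T \<in> Cell C"
  "\<lbrakk>S \<in> Cell C; T \<in> Cell C\<rbrakk> \<Longrightarrow> csrc C (S \<boxtimes> T) = csrc C S \<otimes> csrc C T"
  "\<lbrakk>S \<in> Cell C; T \<in> Cell C\<rbrakk> \<Longrightarrow> ctrg C (S \<boxtimes> T) = ctrg C S \<otimes> ctrg C T"
  using tens.map_obj[of "(X, Y)"] tens.map_arr[of "(f, g)"] tens.map_cell[of "(S, T)"]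
  by (simp_all add: prod_2cat_def arr_in_def cell_in_def)

lemma atens_aid [simp]: "\<lbrakk>X \<in> Obj C; Y \<in> Obj C\<rbrakk> \<Longrightarrow> aid C X \<otimes> aid C Y = aid C (X \<odot> Y)"
  using tens.map_aid[of "(X, Y)"] by (simp add: prod_2cat_def)

lemma ctens_cid [simp]: "\<lbrakk>f \<in> Arr C; g \<in> Arr C\<rbrakk> \<Longrightarrow> cid C f \<boxtimes> cid C g = cid C (f \<otimes> g)"
  using tens.map_cid[of "(f, g)"] by (simp add: prod_2cat_def)

lemma atens_acomp:
  "\<lbrakk>f \<in> Arr C; f' \<in> Arr C; g \<in> Arr C; g' \<in> Arr C; acod C f = adom C f'; acod C g = adom C g'\<rbrakk>
    \<Longrightarrow> (f \<sharp> f') \<otimes> (g \<sharp> g') = (f \<otimes> g) \<sharp> (f' \<otimes> g')"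
  using tens.map_acomp[of "(f, g)" "(f', g')"] by (simp add: prod_2cat_def)

lemma ctens_vcomp:
  "\<lbrakk>S \<in> Cell C; S' \<in> Cell C; T \<in> Cell C; T' \<in> Cell C; ctrg C S = csrc C S'; ctrg C T = csrc C T'\<rbrakk>
    \<Longrightarrow> (S \<bullet> S') \<boxtimes> (T \<bullet> T') = (S \<boxtimes> T) \<bullet> (S' \<boxtimes> T')"
  using tens.map_vcomp[of "(S, T)" "(S', T')"] by (simp add: prod_2cat_def)

lemma ctens_hcomp:
  "\<lbrakk>S \<in> Cell C; S' \<in> Cell C; T \<in> Cell C; T' \<in> Cell C;
     acod C (csrc C S) = adom C (csrc C S'); acod C (csrc C T) = adom C (csrc C T')\<rbrakk>
    \<Longrightarrow> (S \<star> S') \<boxtimes> (T \<star> T') = (S \<boxtimes> T) \<star> (S' \<boxtimes> T')"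
  using tens.map_hcomp[of "(S, T)" "(S', T')"] by (simp add: prod_2cat_def)

text \<open>Functoriality of the tensor, with identities inserted. Together with the mirror
  factorization it lets arrows acting on different tensor factors slide past each other strictly;
  the two lemmas for 2-cells below do the same.\<close>

lemma atens_eq_left_right:
  assumes "f \<in> Arr C" "g \<in> Arr C"
  shows "(f \<otimes> aid C (adom C g)) \<sharp> (aid C (acod C f) \<otimes> g) = f \<otimes> g"
  using assms by (simp flip: atens_acomp)

lemma atens_eq_right_left:
  assumes "f \<in> Arr C" "g \<in> Arr C"
  shows "(aid C (adom C f) \<otimes> g) \<sharp> (f \<otimes> aid C (acod C g)) = f \<otimes> g"
  using assms by (simp flip: atens_acomp)

lemma ctens_eq_left_right:
  assumes "S \<in> Cell C" "T \<in> Cell C"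
  shows "(S \<boxtimes> cid C (aid C (adom C (csrc C T)))) \<star> (cid C (aid C (acod C (csrc C S))) \<boxtimes> T) = S \<boxtimes> T"
  using assms by (simp flip: ctens_hcomp)

lemma ctens_eq_right_left:
  assumes "S \<in> Cell C" "T \<in> Cell C"
  shows "(cid C (aid C (adom C (csrc C S))) \<boxtimes> T) \<star> (S \<boxtimes> cid C (aid C (acod C (csrc C T)))) = S \<boxtimes> T"
  using assms by (simp flip: ctens_hcomp)

lemma cell_iso_atens:
  assumes "cell_iso C f f'" "cell_iso C g g'"
  shows "cell_iso C (f \<otimes> g) (f' \<otimes> g')"
proof -
  obtain S T where S: "invertible_cell C S" "S \<in> Cell C" "csrc C S = f" "ctrg C S = f'"
    and T: "invertible_cell C T" "T \<in> Cell C" "csrc C T = g" "ctrg C T = g'"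
    using assms by (auto simp: cell_iso_def cell_in_def)
  have fg: "f \<in> Arr C" "g \<in> Arr C" "f' \<in> Arr C" "g' \<in> Arr C"
    using S T by auto
  note vi = vinv[OF S(1)] vinv[OF T(1)]
  have "invertible_cell C (S \<boxtimes> T)"
    using S T vi fg by (intro invertible_cellI[of _ "vinv C S \<boxtimes> vinv C T"]) (simp_all flip: ctens_vcomp)
  with S T show ?thesis by (auto simp: cell_iso_def cell_in_def)
qed

lemma equi_arrow_atens_aid_right:
  assumes "equi_arrow C f" and X: "X \<in> Obj C"
  shows "equi_arrow C (f \<otimes> aid C X)"
proof -
  obtain g where g: "f \<in> Arr C" "g \<in> Arr C" "adom C g = acod C f" "acod C g = adom C f"
    "cell_iso C (f \<sharp> g) (aid C (adom C f))" "cell_iso C (g \<sharp> f) (aid C (acod C f))"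
    using assms(1) by (rule equi_arrowE)
  have "(f \<otimes> aid C X) \<sharp> (g \<otimes> aid C X) = (f \<sharp> g) \<otimes> aid C X"
    "(g \<otimes> aid C X) \<sharp> (f \<otimes> aid C X) = (g \<sharp> f) \<otimes> aid C X"
    using g X by (simp_all flip: atens_acomp)
  moreover have "cell_iso C ((f \<sharp> g) \<otimes> aid C X) (aid C (adom C f) \<otimes> aid C X)"
    "cell_iso C ((g \<sharp> f) \<otimes> aid C X) (aid C (acod C f) \<otimes> aid C X)"
    using g X by (auto simp del: atens_aid intro!: cell_iso_atens cell_iso_refl)
  ultimately show ?thesis
    using g X by (intro equi_arrowI[of _ "g \<otimes> aid C X"]) simp_all
qed


section \<open>Units\<close>

context
  fixes J \<beta>
  assumes unit: "unit_object C (J, \<beta>)"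
begin

lemma unit_objectD:
  "J \<in> Obj C" "\<beta> \<in> Arr C" "adom C \<beta> = J \<odot> J" "acod C \<beta> = J" "equi_arrow C \<beta>"
  using unit by (auto simp: unit_object_def cancellable_def arr_in_def)

lemma unit_left_ff:
  "fully_faithful_2functor C C (\<lambda>X. J \<odot> X) (\<lambda>f. aid C J \<otimes> f) (\<lambda>T. cid C (aid C J) \<boxtimes> T)"
  and unit_right_ff:
  "fully_faithful_2functor C C (\<lambda>X. X \<odot> J) (\<lambda>f. f \<otimes> aid C J) (\<lambda>T. T \<boxtimes> cid C (aid C J))"
  using unit by (auto simp: unit_object_def cancellable_def)

text \<open>By strict associativity, \<open>\<beta> \<otimes> aid C X\<close> runs from
  \<open>J \<odot> (J \<odot> X)\<close> to \<open>J \<odot> X\<close>, so cancelling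
  \<open>J\<close> on the left provides \<open>l\<close>. Tensoring with \<open>J\<close> reflects
  equi-arrows, and \<open>\<beta> \<otimes> aid C X\<close> is one.\<close>

lemma left_constraint:
  assumes X: "X \<in> Obj C"
  obtains l where "l \<in> Arr C" "adom C l = J \<odot> X" "acod C l = X" "equi_arrow C l"
    "cell_iso C (aid C J \<otimes> l) (\<beta> \<otimes> aid C X)"
proof -
  note J = unit_objectD
  obtain l where l: "arr_in C l (J \<odot> X) X" "cell_iso C (aid C J \<otimes> l) (\<beta> \<otimes> aid C X)"
    using fully_faithful_ess_surj[OF unit_left_ff, of "J \<odot> X" X "\<beta> \<otimes> aid C X"] J X
    by (auto simp: arr_in_def otens_assoc)
  have "equi_arrow C (aid C J \<otimes> l)"
    by (rule equi_arrow_cell_iso[OF equi_arrow_atens_aid_right[OF J(5) X] cell_iso_sym[OF l(2)]])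
  then have "equi_arrow C l"
    using l(1) by - (rule fully_faithful_reflects_equi[OF unit_left_ff]; simp add: arr_in_def)
  with l that show thesis by (auto simp: arr_in_def)
qed

text \<open>A unit carries no associator as data; one is produced here because
  \<open>aid C J \<otimes> \<beta>\<close> and \<open>\<beta> \<otimes> aid C J\<close> both turn
  out to be isomorphic to \<open>aid C J \<otimes> l\<close>.\<close>

lemma unit_associative: "cell_iso C (aid C J \<otimes> \<beta>) (\<beta> \<otimes> aid C J)"
proof -
  note J [simp] = unit_objectD
  obtain l where l [simp]: "l \<in> Arr C" "adom C l = J \<odot> J" "acod C l = J"
    and l_equi: "equi_arrow C l" and l_iso: "cell_iso C (aid C J \<otimes> l) (\<beta> \<otimes> aid C J)"
    using left_constraint[OF J(1)] by metis
  \<comment> \<open>The identity of \<open>J\<close> is doubled so that tensoring with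
    \<open>J\<close> distributes over the composite. The chain replaces the second
    \<open>aid C J \<otimes> l\<close> by \<open>\<beta> \<otimes> aid C J\<close>, slides it to the
    front, and there replaces \<open>\<beta> \<otimes> aid C J\<close>, still tensored with
    \<open>J\<close>, by \<open>aid C J \<otimes> l\<close> again.\<close>
  have "aid C J \<otimes> ((aid C J \<otimes> l) \<sharp> l) = (aid C J \<sharp> aid C J) \<otimes> ((aid C J \<otimes> l) \<sharp> l)"
    by simp
  also have "\<dots> = (aid C (J \<odot> J) \<otimes> l) \<sharp> (aid C J \<otimes> l)"
    by (subst atens_acomp) (simp_all del: atens_aid flip: atens_assoc, simp)
  also have "cell_iso C \<dots> ((aid C (J \<odot> J) \<otimes> l) \<sharp> (\<beta> \<otimes> aid C J))"
    by (intro cell_iso_acomp cell_iso_refl l_iso) (simp_all add: otens_assoc)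
  \<comment> \<open>Both sides are equal to \<open>\<beta> \<otimes> l\<close>.\<close>
  also have "(aid C (J \<odot> J) \<otimes> l) \<sharp> (\<beta> \<otimes> aid C J) = (\<beta> \<otimes> aid C (J \<odot> J)) \<sharp> (aid C J \<otimes> l)"
    using atens_eq_left_right[of \<beta> l] atens_eq_right_left[of \<beta> l] by simp
  also have "\<dots> = ((\<beta> \<otimes> aid C J) \<otimes> aid C J) \<sharp> (aid C J \<otimes> l)"
    by (simp add: atens_assoc)
  also have "cell_iso C \<dots> (((aid C J \<otimes> l) \<otimes> aid C J) \<sharp> (aid C J \<otimes> l))"
    by (intro cell_iso_acomp cell_iso_atens cell_iso_refl cell_iso_sym[OF l_iso])
       (simp_all add: otens_assoc)
  also have "((aid C J \<otimes> l) \<otimes> aid C J) \<sharp> (aid C J \<otimes> l) = (aid C J \<sharp> aid C J) \<otimes> ((l \<otimes> aid C J) \<sharp> l)"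
    by (subst atens_acomp) (simp_all add: atens_assoc)
  also have "\<dots> = aid C J \<otimes> ((l \<otimes> aid C J) \<sharp> l)"
    by simp
  finally have "cell_iso C ((aid C J \<otimes> l) \<sharp> l) ((l \<otimes> aid C J) \<sharp> l)"
    by (rule fully_faithful_reflects_cell_iso[OF unit_left_ff, rotated 4])
       (simp_all add: otens_assoc)
  then have "cell_iso C (aid C J \<otimes> l) (l \<otimes> aid C J)"
    by (rule cell_iso_acomp_equi_cancel[OF l_equi]) (simp_all add: otens_assoc)
  \<comment> \<open>From here \<open>J\<close> can be cancelled on the right, which identifies
    \<open>\<beta>\<close> with \<open>l\<close> up to isomorphism; tensoring with \<open>J\<close>
    on the left then reduces the claim to \<open>l_iso\<close>.\<close>
  with l_iso have "cell_iso C (\<beta> \<otimes> aid C J) (l \<otimes> aid C J)"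
    by (blast intro: cell_iso_sym cell_iso_trans)
  then have "cell_iso C \<beta> l"
    by (rule fully_faithful_reflects_cell_iso[OF unit_right_ff, rotated 4]) simp_all
  then have "cell_iso C (aid C J \<otimes> \<beta>) (aid C J \<otimes> l)"
    by (intro cell_iso_atens cell_iso_refl) simp_all
  from this l_iso show ?thesis by (rule cell_iso_trans)
qed

text \<open>The cells \<open>L\<close> and \<open>A\<close> are chosen once, before \<open>u\<close>
  varies. This is why the family built from them is natural in \<open>u\<close>, although the
  individual 2-cells come from mere existence statements.\<close>

lemma unit_naturality:
  assumes I: "I \<in> Obj C"
  obtains \<mu> N where "\<mu> \<in> Arr C" "adom C \<mu> = J \<odot> I" "acod C \<mu> = I" "equi_arrow C \<mu>"
    and "\<And>u. arr_in C u I J \<Longrightarrow> invertible_cell C (N u)"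
    and "\<And>u. arr_in C u I J \<Longrightarrow> cell_in C (N u) ((aid C J \<otimes> u) \<sharp> \<beta>) (\<mu> \<sharp> u)"
    and "\<And>u v T. \<lbrakk>arr_in C u I J; cell_in C T u v\<rbrakk> \<Longrightarrow>
      ((cid C (aid C J) \<boxtimes> T) \<star> cid C \<beta>) \<bullet> N v = N u \<bullet> (cid C \<mu> \<star> T)"
proof -
  note J [simp] = unit_objectD
  let ?i = "cid C (aid C J)" and ?ii = "cid C (aid C (J \<odot> J))"
  obtain \<mu> where \<mu> [simp]: "\<mu> \<in> Arr C" "adom C \<mu> = J \<odot> I" "acod C \<mu> = I"
    and \<mu>_equi: "equi_arrow C \<mu>" and \<mu>_iso: "cell_iso C (aid C J \<otimes> \<mu>) (\<beta> \<otimes> aid C I)"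
    using left_constraint[OF I] by metis
  obtain L where L: "invertible_cell C L"
    and L_in [simp]: "L \<in> Cell C" "csrc C L = \<beta> \<otimes> aid C I" "ctrg C L = aid C J \<otimes> \<mu>"
    using cell_iso_sym[OF \<mu>_iso] by (auto simp: cell_iso_def cell_in_def)
  obtain A where A: "invertible_cell C A"
    and A_in [simp]: "A \<in> Cell C" "csrc C A = aid C J \<otimes> \<beta>" "ctrg C A = \<beta> \<otimes> aid C J"
    using unit_associative by (auto simp: cell_iso_def cell_in_def)
  \<comment> \<open>\<open>K u\<close> is what \<open>N u\<close> must become after tensoring with
    \<open>J\<close>: first \<open>A\<close> turns \<open>aid C J \<otimes> \<beta>\<close> into
    \<open>\<beta> \<otimes> aid C J\<close>, then \<open>u\<close> slides past
    \<open>\<beta>\<close> by the equation \<open>mid\<close>, and \<open>L\<close> turns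
    \<open>\<beta> \<otimes> aid C I\<close> into \<open>aid C J \<otimes> \<mu>\<close>.\<close>
  define K where "K u = (cid C (aid C (J \<odot> J) \<otimes> u) \<star> A) \<bullet> (L \<star> cid C (aid C J \<otimes> u))" for u
  have mid: "(aid C (J \<odot> J) \<otimes> u) \<sharp> (\<beta> \<otimes> aid C J) = (\<beta> \<otimes> aid C I) \<sharp> (aid C J \<otimes> u)"
    if "u \<in> Arr C" "adom C u = I" "acod C u = J" for u
    using atens_eq_left_right[of \<beta> u] atens_eq_right_left[of \<beta> u] that by simp
  have whisk: "aid C J \<otimes> (f \<sharp> g) = (aid C J \<otimes> f) \<sharp> (aid C J \<otimes> g)"
    if "f \<in> Arr C" "g \<in> Arr C" "acod C f = adom C g" for f g
    using atens_acomp[of "aid C J" "aid C J" f g] that by simp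
  have ass: "aid C J \<otimes> (aid C J \<otimes> f) = aid C (J \<odot> J) \<otimes> f" if "f \<in> Arr C" for f
    using that by (simp flip: atens_assoc)
  have K: "invertible_cell C (K u)" "cell_in C (K u) (aid C J \<otimes> ((aid C J \<otimes> u) \<sharp> \<beta>)) (aid C J \<otimes> (\<mu> \<sharp> u))"
    if "u \<in> Arr C" "adom C u = I" "acod C u = J" for u
  proof -
    show "invertible_cell C (K u)"
      unfolding K_def using that I mid[OF that]
      by (intro invertible_vcomp invertible_hcomp invertible_cid A L) (simp_all add: otens_assoc)
    show "cell_in C (K u) (aid C J \<otimes> ((aid C J \<otimes> u) \<sharp> \<beta>)) (aid C J \<otimes> (\<mu> \<sharp> u))"
      unfolding K_def cell_in_def using that I mid[OF that]
      by (simp add: otens_assoc whisk ass)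
  qed
  \<comment> \<open>Boundary and invertibility of \<open>K u\<close> descend along the fully
    faithful tensoring with \<open>J\<close>.\<close>
  have "\<exists>R. invertible_cell C R \<and> cell_in C R ((aid C J \<otimes> u) \<sharp> \<beta>) (\<mu> \<sharp> u) \<and> ?i \<boxtimes> R = K u"
    if "arr_in C u I J" for u
  proof -
    have u: "u \<in> Arr C" "adom C u = I" "acod C u = J" using that by (auto simp: arr_in_def)
    then obtain R where R: "cell_in C R ((aid C J \<otimes> u) \<sharp> \<beta>) (\<mu> \<sharp> u)" "?i \<boxtimes> R = K u"
      using fully_faithful_full[OF unit_left_ff _ _ _ _ K(2)[OF u]] by auto
    moreover have "invertible_cell C R"
      using R K(1)[OF u]
      by - (rule fully_faithful_reflects_invertible[OF unit_left_ff]; simp add: cell_in_def)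
    ultimately show ?thesis by blast
  qed
  then obtain N where N: "\<And>u. arr_in C u I J \<Longrightarrow> invertible_cell C (N u)"
    "\<And>u. arr_in C u I J \<Longrightarrow> cell_in C (N u) ((aid C J \<otimes> u) \<sharp> \<beta>) (\<mu> \<sharp> u)"
    "\<And>u. arr_in C u I J \<Longrightarrow> ?i \<boxtimes> N u = K u"
    by metis
  have nat: "((?i \<boxtimes> T) \<star> cid C \<beta>) \<bullet> N v = N u \<bullet> (cid C \<mu> \<star> T)"
    if u': "arr_in C u I J" and T': "cell_in C T u v" for u v T
  proof -
    have v': "arr_in C v I J"
      using u' cell_in_arr[OF T'] by (auto simp: arr_in_def)
    have [simp]: "u \<in> Arr C" "adom C u = I" "acod C u = J" "v \<in> Arr C" "adom C v = I" "acod C v = J"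
      "T \<in> Cell C" "csrc C T = u" "ctrg C T = v"
      using u' v' T' by (auto simp: arr_in_def cell_in_def)
    have [simp]: "N u \<in> Cell C" "csrc C (N u) = (aid C J \<otimes> u) \<sharp> \<beta>" "ctrg C (N u) = \<mu> \<sharp> u"
      "N v \<in> Cell C" "csrc C (N v) = (aid C J \<otimes> v) \<sharp> \<beta>" "ctrg C (N v) = \<mu> \<sharp> v"
      using N(2)[OF u'] N(2)[OF v'] by (auto simp: cell_in_def)
    have whisk2: "?i \<boxtimes> (R \<star> S) = (?i \<boxtimes> R) \<star> (?i \<boxtimes> S)"
      if "R \<in> Cell C" "S \<in> Cell C" "acod C (csrc C R) = adom C (csrc C S)" for R S
      using ctens_hcomp[of ?i ?i R S] that by simp
    have whisk3: "?i \<boxtimes> (R \<bullet> S) = (?i \<boxtimes> R) \<bullet> (?i \<boxtimes> S)"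
      if "R \<in> Cell C" "S \<in> Cell C" "ctrg C R = csrc C S" for R S
      using ctens_vcomp[of ?i ?i R S] that by simp
    have ass2: "?i \<boxtimes> (?i \<boxtimes> T) = ?ii \<boxtimes> T"
      by (simp flip: ctens_assoc)
    \<comment> \<open>\<open>s1\<close> and \<open>s3\<close> move \<open>T\<close> past the fixed
      cells \<open>A\<close> and \<open>L\<close>, while \<open>s2\<close> slides it past
      \<open>\<beta>\<close>. Pasted together they give naturality of \<open>K\<close>, and hence of
      \<open>N\<close>, by faithfulness of tensoring with \<open>J\<close>.\<close>
    have s1: "((?ii \<boxtimes> T) \<star> cid C (aid C J \<otimes> \<beta>)) \<bullet> (cid C (aid C (J \<odot> J) \<otimes> v) \<star> A)
        = (cid C (aid C (J \<odot> J) \<otimes> u) \<star> A) \<bullet> ((?ii \<boxtimes> T) \<star> cid C (\<beta> \<otimes> aid C J))"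
      using hcomp_eq_left_right[of "?ii \<boxtimes> T" A] hcomp_eq_right_left[of "?ii \<boxtimes> T" A] I
      by (simp add: otens_assoc)
    have s2: "(?ii \<boxtimes> T) \<star> cid C (\<beta> \<otimes> aid C J) = cid C (\<beta> \<otimes> aid C I) \<star> (?i \<boxtimes> T)"
      using ctens_eq_left_right[of "cid C \<beta>" T] ctens_eq_right_left[of "cid C \<beta>" T] I by simp
    have s3: "(cid C (\<beta> \<otimes> aid C I) \<star> (?i \<boxtimes> T)) \<bullet> (L \<star> cid C (aid C J \<otimes> v))
        = (L \<star> cid C (aid C J \<otimes> u)) \<bullet> (cid C (aid C J \<otimes> \<mu>) \<star> (?i \<boxtimes> T))"
      using hcomp_eq_left_right[of L "?i \<boxtimes> T"] hcomp_eq_right_left[of L "?i \<boxtimes> T"] I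
      by simp
    have "?i \<boxtimes> (((?i \<boxtimes> T) \<star> cid C \<beta>) \<bullet> N v) = ((?ii \<boxtimes> T) \<star> cid C (aid C J \<otimes> \<beta>)) \<bullet> K v"
      using I by (simp add: whisk2 whisk3 ass2 N(3)[OF v'])
    also have "\<dots> = (((?ii \<boxtimes> T) \<star> cid C (aid C J \<otimes> \<beta>)) \<bullet> (cid C (aid C (J \<odot> J) \<otimes> v) \<star> A))
        \<bullet> (L \<star> cid C (aid C J \<otimes> v))"
      unfolding K_def using I mid[of v] by (simp add: vcomp_assoc otens_assoc)
    also have "\<dots> = (cid C (aid C (J \<odot> J) \<otimes> u) \<star> A) \<bullet>
        ((cid C (\<beta> \<otimes> aid C I) \<star> (?i \<boxtimes> T)) \<bullet> (L \<star> cid C (aid C J \<otimes> v)))"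
      unfolding s1 s2 using I mid[of u] by (simp add: vcomp_assoc otens_assoc)
    also have "\<dots> = K u \<bullet> (cid C (aid C J \<otimes> \<mu>) \<star> (?i \<boxtimes> T))"
      unfolding s3 K_def using I mid[of u] by (simp add: vcomp_assoc otens_assoc)
    also have "\<dots> = ?i \<boxtimes> (N u \<bullet> (cid C \<mu> \<star> T))"
      using I by (simp add: whisk2 whisk3 N(3)[OF u'])
    finally show ?thesis
      using I by - (rule fully_faithful_faithful[OF unit_left_ff]; simp)
  qed
  show thesis
    by (rule that[of \<mu> N]) (use \<mu>_equi N nat in simp_all)
qed

end

text \<open>With \<open>\<nu>\<close> a pseudo-inverse of \<open>\<mu>\<close>, right cancellability
  of \<open>I\<close> solves \<open>u \<otimes> aid C I\<close> against
  \<open>\<alpha> \<sharp> \<nu>\<close> up to isomorphism. Composing with \<open>\<mu>\<close>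
  gives \<open>\<alpha>\<close>, and \<open>N u\<close> converts this into the required
  2-cell.\<close>

lemma unit_morphism_exists:
  assumes "unit_object C (I, \<alpha>)" "unit_object C (J, \<beta>)"
  shows "\<exists>u U. unit_morphism C (I, \<alpha>) (J, \<beta>) (u, U)"
proof -
  note I [simp] = unit_objectD[OF assms(1)] and J [simp] = unit_objectD[OF assms(2)]
  obtain \<mu> N where \<mu> [simp]: "\<mu> \<in> Arr C" "adom C \<mu> = J \<odot> I" "acod C \<mu> = I" "equi_arrow C \<mu>"
    and N: "\<And>u. arr_in C u I J \<Longrightarrow> invertible_cell C (N u)"
      "\<And>u. arr_in C u I J \<Longrightarrow> cell_in C (N u) ((aid C J \<otimes> u) \<sharp> \<beta>) (\<mu> \<sharp> u)"
    using unit_naturality[OF assms(2) I(1)] by metis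
  obtain \<nu> where \<nu> [simp]: "\<nu> \<in> Arr C" "adom C \<nu> = I" "acod C \<nu> = J \<odot> I" "equi_arrow C \<nu>"
    and \<nu>\<mu>: "cell_iso C (\<nu> \<sharp> \<mu>) (aid C I)"
    using \<mu>(4) by (rule equi_arrowE) simp
  obtain u where u': "arr_in C u I J" and u_iso: "cell_iso C (u \<otimes> aid C I) (\<alpha> \<sharp> \<nu>)"
    using fully_faithful_ess_surj[OF unit_right_ff[OF assms(1)], of I J "\<alpha> \<sharp> \<nu>"]
    by (auto simp: arr_in_def)
  have u [simp]: "u \<in> Arr C" "adom C u = I" "acod C u = J"
    using u' by (auto simp: arr_in_def)
  \<comment> \<open>It is isomorphic to a composite of the equi-arrows \<open>\<alpha>\<close> and
    \<open>\<nu>\<close>, and tensoring with \<open>I\<close> reflects equi-arrows.\<close>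
  have "equi_arrow C (u \<otimes> aid C I)"
    by (rule equi_arrow_cell_iso[OF _ cell_iso_sym[OF u_iso]]) (rule equi_arrow_acomp; simp)
  then have u_equi: "equi_arrow C u"
    by - (rule fully_faithful_reflects_equi[OF unit_right_ff[OF assms(1)]]; simp)
  have "cell_iso C ((u \<otimes> aid C I) \<sharp> \<mu>) ((\<alpha> \<sharp> \<nu>) \<sharp> \<mu>)"
    by (intro cell_iso_acomp u_iso cell_iso_refl) simp_all
  also have "(\<alpha> \<sharp> \<nu>) \<sharp> \<mu> = \<alpha> \<sharp> (\<nu> \<sharp> \<mu>)"
    by (simp add: acomp_assoc)
  also have "cell_iso C \<dots> (\<alpha> \<sharp> aid C I)"
    by (intro cell_iso_acomp \<nu>\<mu> cell_iso_refl) simp_all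
  finally have 1: "cell_iso C ((u \<otimes> aid C I) \<sharp> \<mu>) \<alpha>"
    by simp
  have "(u \<otimes> u) \<sharp> \<beta> = (u \<otimes> aid C I) \<sharp> ((aid C J \<otimes> u) \<sharp> \<beta>)"
    using atens_eq_left_right[of u u] by (simp flip: acomp_assoc)
  also have "cell_iso C \<dots> ((u \<otimes> aid C I) \<sharp> (\<mu> \<sharp> u))"
    by (rule cell_iso_acomp[OF cell_iso_refl]) (use N[OF u'] in \<open>auto simp: cell_iso_def\<close>)
  also have "(u \<otimes> aid C I) \<sharp> (\<mu> \<sharp> u) = ((u \<otimes> aid C I) \<sharp> \<mu>) \<sharp> u"
    by (simp add: acomp_assoc)
  also have "cell_iso C \<dots> (\<alpha> \<sharp> u)"
    by (intro cell_iso_acomp 1 cell_iso_refl) simp_all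
  finally have "cell_iso C (\<alpha> \<sharp> u) ((u \<otimes> u) \<sharp> \<beta>)"
    by (rule cell_iso_sym)
  with assms u' u_equi show ?thesis
    by (auto simp: unit_morphism_def cell_iso_def)
qed

text \<open>\<open>T\<close> occurs twice in the equation of a unit 2-morphism. Passing to
  \<open>U'\<close> and \<open>V'\<close> leaves an equation in which it occurs once and under fully
  faithful operations, so it can be solved.\<close>

lemma unit_2morphism_unique_exists:
  assumes uU: "unit_morphism C (I, \<alpha>) (J, \<beta>) (u, U)" and vV: "unit_morphism C (I, \<alpha>) (J, \<beta>) (v, V)"
  shows "\<exists>!T. unit_2morphism C (I, \<alpha>) (J, \<beta>) (u, U) (v, V) T"
proof -
  have units: "unit_object C (I, \<alpha>)" "unit_object C (J, \<beta>)"
    using uU by (auto simp: unit_morphism_def)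
  note I [simp] = unit_objectD[OF units(1)] and J [simp] = unit_objectD[OF units(2)]
  let ?i = "cid C (aid C I)" and ?j = "cid C (aid C J)"
  obtain \<mu> N where \<mu> [simp]: "\<mu> \<in> Arr C" "adom C \<mu> = J \<odot> I" "acod C \<mu> = I" "equi_arrow C \<mu>"
    and N: "\<And>u. arr_in C u I J \<Longrightarrow> invertible_cell C (N u)"
      "\<And>u. arr_in C u I J \<Longrightarrow> cell_in C (N u) ((aid C J \<otimes> u) \<sharp> \<beta>) (\<mu> \<sharp> u)"
    and nat: "\<And>u v T. \<lbrakk>arr_in C u I J; cell_in C T u v\<rbrakk> \<Longrightarrow>
      ((?j \<boxtimes> T) \<star> cid C \<beta>) \<bullet> N v = N u \<bullet> (cid C \<mu> \<star> T)"
    using unit_naturality[OF units(2) I(1)] by metis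
  have split: "(w \<otimes> w) \<sharp> \<beta> = (w \<otimes> aid C I) \<sharp> ((aid C J \<otimes> w) \<sharp> \<beta>)"
    if "w \<in> Arr C" "adom C w = I" "acod C w = J" for w
    using atens_eq_left_right[of w w] that by (simp flip: acomp_assoc)
  \<comment> \<open>Extending \<open>W\<close> by \<open>N w\<close> gives a cell from
    \<open>\<alpha> \<sharp> w\<close> whose target also ends in \<open>w\<close>; since
    \<open>w\<close> is an equi-arrow, that trailing \<open>w\<close> can be stripped.\<close>
  have hat: "\<exists>H. invertible_cell C H \<and> cell_in C H \<alpha> ((w \<otimes> aid C I) \<sharp> \<mu>) \<and>
      H \<star> cid C w = W \<bullet> (cid C (w \<otimes> aid C I) \<star> N w)"
    if "unit_morphism C (I, \<alpha>) (J, \<beta>) (w, W)" for w W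
  proof -
    have w': "arr_in C w I J" and W: "invertible_cell C W"
      and w [simp]: "equi_arrow C w" "w \<in> Arr C" "adom C w = I" "acod C w = J"
      and [simp]: "W \<in> Cell C" "csrc C W = \<alpha> \<sharp> w" "ctrg C W = (w \<otimes> w) \<sharp> \<beta>"
      using that by (auto simp: unit_morphism_def cell_in_def arr_in_def)
    have [simp]: "N w \<in> Cell C" "csrc C (N w) = (aid C J \<otimes> w) \<sharp> \<beta>" "ctrg C (N w) = \<mu> \<sharp> w"
      using N(2)[OF w'] by (auto simp: cell_in_def)
    let ?R = "W \<bullet> (cid C (w \<otimes> aid C I) \<star> N w)"
    have inv: "invertible_cell C ?R"
      by (intro invertible_vcomp W invertible_hcomp N(1) w' invertible_cid) (simp_all add: split)
    have "cell_in C ?R (\<alpha> \<sharp> w) (((w \<otimes> aid C I) \<sharp> \<mu>) \<sharp> w)"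
      by (simp add: cell_in_def split acomp_assoc)
    then obtain H where H: "cell_in C H \<alpha> ((w \<otimes> aid C I) \<sharp> \<mu>)" "H \<star> cid C w = ?R"
      using whisker_equi_full[OF w(1), of \<alpha> "(w \<otimes> aid C I) \<sharp> \<mu>" ?R] by auto
    moreover have "invertible_cell C H"
      by (rule whisker_equi_reflects_invertible[OF w(1) H(1)]) (use H(2) inv in simp_all)
    ultimately show ?thesis by blast
  qed
  obtain U' where U': "invertible_cell C U'" "cell_in C U' \<alpha> ((u \<otimes> aid C I) \<sharp> \<mu>)"
    "U' \<star> cid C u = U \<bullet> (cid C (u \<otimes> aid C I) \<star> N u)"
    using hat[OF uU] by blast
  obtain V' where V': "invertible_cell C V'" "cell_in C V' \<alpha> ((v \<otimes> aid C I) \<sharp> \<mu>)"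
    "V' \<star> cid C v = V \<bullet> (cid C (v \<otimes> aid C I) \<star> N v)"
    using hat[OF vV] by blast
  have u': "arr_in C u I J" and U: "invertible_cell C U"
    and u [simp]: "equi_arrow C u" "u \<in> Arr C" "adom C u = I" "acod C u = J"
    and [simp]: "U \<in> Cell C" "csrc C U = \<alpha> \<sharp> u" "ctrg C U = (u \<otimes> u) \<sharp> \<beta>"
    using uU by (auto simp: unit_morphism_def cell_in_def arr_in_def)
  have v': "arr_in C v I J" and V: "invertible_cell C V"
    and v [simp]: "equi_arrow C v" "v \<in> Arr C" "adom C v = I" "acod C v = J"
    and [simp]: "V \<in> Cell C" "csrc C V = \<alpha> \<sharp> v" "ctrg C V = (v \<otimes> v) \<sharp> \<beta>"
    using vV by (auto simp: unit_morphism_def cell_in_def arr_in_def)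
  have [simp]: "N u \<in> Cell C" "csrc C (N u) = (aid C J \<otimes> u) \<sharp> \<beta>" "ctrg C (N u) = \<mu> \<sharp> u"
    "N v \<in> Cell C" "csrc C (N v) = (aid C J \<otimes> v) \<sharp> \<beta>" "ctrg C (N v) = \<mu> \<sharp> v"
    using N(2)[OF u'] N(2)[OF v'] by (auto simp: cell_in_def)
  have [simp]: "U' \<in> Cell C" "csrc C U' = \<alpha>" "ctrg C U' = (u \<otimes> aid C I) \<sharp> \<mu>"
    "V' \<in> Cell C" "csrc C V' = \<alpha>" "ctrg C V' = (v \<otimes> aid C I) \<sharp> \<mu>"
    using U'(2) V'(2) by (auto simp: cell_in_def)
  have key: "U \<bullet> ((T \<boxtimes> T) \<star> cid C \<beta>) = (cid C \<alpha> \<star> T) \<bullet> V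
      \<longleftrightarrow> U' \<bullet> ((T \<boxtimes> ?i) \<star> cid C \<mu>) = V'"
    if T': "cell_in C T u v" and T_inv: "invertible_cell C T" for T
  proof -
    have [simp]: "T \<in> Cell C" "csrc C T = u" "ctrg C T = v"
      using T' by (auto simp: cell_in_def)
    \<comment> \<open>Composing with the invertible \<open>X\<close> loses no information and turns
      the two sides of the equation into \<open>P \<star> T\<close> and
      \<open>V' \<star> T\<close>.\<close>
    define X where "X = cid C (v \<otimes> aid C I) \<star> N v"
    define P where "P = U' \<bullet> ((T \<boxtimes> ?i) \<star> cid C \<mu>)"
    have X: "invertible_cell C X"
      unfolding X_def using v' by (intro invertible_hcomp N(1) invertible_cid) simp_all
    have X_in [simp]: "X \<in> Cell C" "csrc C X = (v \<otimes> v) \<sharp> \<beta>"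
      by (simp_all add: X_def split)
    have P_in [simp]: "P \<in> Cell C" "csrc C P = \<alpha>" "ctrg C P = (v \<otimes> aid C I) \<sharp> \<mu>"
      by (simp_all add: P_def)
    \<comment> \<open>One copy of \<open>T\<close> acts on each tensor factor. Naturality of
      \<open>N\<close> carries the copy next to \<open>\<beta>\<close> through to the end, behind
      \<open>\<mu>\<close>.\<close>
    have "T \<boxtimes> T = (T \<boxtimes> ?i) \<star> (?j \<boxtimes> T)"
      using ctens_eq_left_right[of T T] by simp
    then have "((T \<boxtimes> T) \<star> cid C \<beta>) \<bullet> X = ((T \<boxtimes> ?i) \<star> ((?j \<boxtimes> T) \<star> cid C \<beta>)) \<bullet> X"
      by (simp add: hcomp_assoc)
    also have "\<dots> = (T \<boxtimes> ?i) \<star> (((?j \<boxtimes> T) \<star> cid C \<beta>) \<bullet> N v)"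
      unfolding X_def by (simp flip: interchange)
    also have "\<dots> = (T \<boxtimes> ?i) \<star> (N u \<bullet> (cid C \<mu> \<star> T))"
      by (simp only: nat[OF u' T'])
    also have "\<dots> = (cid C (u \<otimes> aid C I) \<star> N u) \<bullet> ((T \<boxtimes> ?i) \<star> (cid C \<mu> \<star> T))"
      by (simp flip: interchange)
    finally have 1: "((T \<boxtimes> T) \<star> cid C \<beta>) \<bullet> X
        = (cid C (u \<otimes> aid C I) \<star> N u) \<bullet> ((T \<boxtimes> ?i) \<star> (cid C \<mu> \<star> T))" .
    have "(U \<bullet> ((T \<boxtimes> T) \<star> cid C \<beta>)) \<bullet> X
        = (U \<bullet> (cid C (u \<otimes> aid C I) \<star> N u)) \<bullet> ((T \<boxtimes> ?i) \<star> (cid C \<mu> \<star> T))"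
      by (simp add: vcomp_assoc 1 split)
    also have "\<dots> = (U' \<star> cid C u) \<bullet> (((T \<boxtimes> ?i) \<star> cid C \<mu>) \<star> T)"
      by (simp add: U'(3) hcomp_assoc)
    also have "\<dots> = P \<star> T"
      unfolding P_def by (simp flip: interchange)
    finally have lhs: "(U \<bullet> ((T \<boxtimes> T) \<star> cid C \<beta>)) \<bullet> X = P \<star> T" .
    have "((cid C \<alpha> \<star> T) \<bullet> V) \<bullet> X = (cid C \<alpha> \<star> T) \<bullet> (V' \<star> cid C v)"
      by (simp add: vcomp_assoc V'(3) flip: X_def)
    also have "\<dots> = V' \<star> T"
      by (simp flip: interchange)
    finally have rhs: "((cid C \<alpha> \<star> T) \<bullet> V) \<bullet> X = V' \<star> T" .
    have "U \<bullet> ((T \<boxtimes> T) \<star> cid C \<beta>) = (cid C \<alpha> \<star> T) \<bullet> V \<longleftrightarrow> P \<star> T = V' \<star> T"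
    proof
      assume "P \<star> T = V' \<star> T"
      with lhs rhs have "(U \<bullet> ((T \<boxtimes> T) \<star> cid C \<beta>)) \<bullet> X = ((cid C \<alpha> \<star> T) \<bullet> V) \<bullet> X"
        by simp
      then show "U \<bullet> ((T \<boxtimes> T) \<star> cid C \<beta>) = (cid C \<alpha> \<star> T) \<bullet> V"
        by - (rule vcomp_right_cancel[OF X]; simp)
    qed (use lhs rhs in simp)
    also have "\<dots> \<longleftrightarrow> P = V'"
    proof
      assume "P \<star> T = V' \<star> T"
      \<comment> \<open>\<open>P\<close> and \<open>V'\<close> have the same target, so the factor
        containing \<open>T\<close> is the same on both sides. It is invertible and cancels; the
        equi-arrow \<open>u\<close> is then stripped.\<close>
      then have "(P \<star> cid C u) \<bullet> (cid C ((v \<otimes> aid C I) \<sharp> \<mu>) \<star> T)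
          = (V' \<star> cid C u) \<bullet> (cid C ((v \<otimes> aid C I) \<sharp> \<mu>) \<star> T)"
        using hcomp_eq_left_right[of P T] hcomp_eq_left_right[of V' T] by simp
      moreover have "invertible_cell C (cid C ((v \<otimes> aid C I) \<sharp> \<mu>) \<star> T)"
        by (intro invertible_hcomp T_inv invertible_cid) simp_all
      ultimately have "P \<star> cid C u = V' \<star> cid C u"
        by - (erule vcomp_right_cancel[rotated 5]; simp)
      then show "P = V'"
        by - (rule whisker_equi_faithful[OF u(1)]; simp)
    qed simp
    finally show ?thesis unfolding P_def .
  qed
  have "\<exists>T. cell_in C T u v \<and> invertible_cell C T \<and> U' \<bullet> ((T \<boxtimes> ?i) \<star> cid C \<mu>) = V'"
  proof -
    note vi = vinv[OF U'(1)]
    \<comment> \<open>The equation forces \<open>(T \<boxtimes> ?i) \<star> cid C \<mu>\<close> to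
      be this cell; stripping first \<open>\<mu>\<close> and then the tensor factor \<open>I\<close>
      recovers \<open>T\<close>, and each stage reflects invertibility.\<close>
    let ?Q = "vinv C U' \<bullet> V'"
    have Q_inv: "invertible_cell C ?Q"
      using U'(1) V'(1) vi by (intro invertible_vcomp invertible_vinv) simp_all
    have Q: "cell_in C ?Q ((u \<otimes> aid C I) \<sharp> \<mu>) ((v \<otimes> aid C I) \<sharp> \<mu>)"
      using vi by (simp add: cell_in_def)
    then obtain R where R: "cell_in C R (u \<otimes> aid C I) (v \<otimes> aid C I)" "R \<star> cid C \<mu> = ?Q"
      using whisker_equi_full[OF \<mu>(4), of "u \<otimes> aid C I" "v \<otimes> aid C I" ?Q] by auto
    have R_inv: "invertible_cell C R"
      by (rule whisker_equi_reflects_invertible[OF \<mu>(4) R(1)]) (use R Q_inv in simp_all)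
    obtain T where T: "cell_in C T u v" "T \<boxtimes> ?i = R"
      using fully_faithful_full[OF unit_right_ff[OF units(1)] _ _ _ _ R(1)] by auto
    have "invertible_cell C T"
      using T R_inv
      by - (rule fully_faithful_reflects_invertible[OF unit_right_ff[OF units(1)]]; simp add: cell_in_def)
    moreover have "U' \<bullet> ?Q = (U' \<bullet> vinv C U') \<bullet> V'"
      using vi(1-3) by (simp add: vcomp_assoc)
    then have "U' \<bullet> ?Q = V'"
      using vi(4) by simp
    ultimately show ?thesis
      using T R(2) by auto
  qed
  then obtain T where "cell_in C T u v" "invertible_cell C T" "U' \<bullet> ((T \<boxtimes> ?i) \<star> cid C \<mu>) = V'"
    by blast
  moreover have "S = T"
    if S: "cell_in C S u v" "U' \<bullet> ((S \<boxtimes> ?i) \<star> cid C \<mu>) = V'"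
      and T: "cell_in C T u v" "U' \<bullet> ((T \<boxtimes> ?i) \<star> cid C \<mu>) = V'" for S T
  proof -
    have [simp]: "S \<in> Cell C" "csrc C S = u" "ctrg C S = v" "T \<in> Cell C" "csrc C T = u" "ctrg C T = v"
      using S T by (auto simp: cell_in_def)
    have "(S \<boxtimes> ?i) \<star> cid C \<mu> = (T \<boxtimes> ?i) \<star> cid C \<mu>"
      using S(2) T(2) by - (rule vcomp_left_cancel[OF U'(1)]; simp)
    then have "S \<boxtimes> ?i = T \<boxtimes> ?i"
      by - (rule whisker_equi_faithful[OF \<mu>(4)]; simp)
    then show ?thesis
      by - (rule fully_faithful_faithful[OF unit_right_ff[OF units(1)]]; simp)
  qed
  ultimately show ?thesis
    using uU vV key by (auto simp: unit_2morphism_def)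
qed

end


section \<open>Contractibility\<close>

lemma strict_2category_terminal: "strict_2category terminal_2cat"
  by unfold_locales (simp_all add: terminal_2cat_def arr_in_def cell_in_def)

lemma (in strict_2category) category_hom_cat: "category (hom_cat C X Y)"
  by unfold_locales (auto simp: arr_in_def vcomp_assoc)

text \<open>Uniqueness of cells makes each hom category indiscrete, and existence of arrows makes it
  nonempty. The constant functor at any arrow \<open>h\<close> is then an inverse equivalence to the
  functor into the terminal hom category.\<close>

lemma contractible_2catI:
  fixes C :: "('o, 'a, 'c, 'm) two_cat_scheme"
  assumes C: "strict_2category C" and ne: "Obj C \<noteq> {}"
    and arr: "\<And>X Y. \<lbrakk>X \<in> Obj C; Y \<in> Obj C\<rbrakk> \<Longrightarrow> \<exists>f. arr_in C f X Y"
    and cell: "\<And>f g X Y. \<lbrakk>arr_in C f X Y; arr_in C g X Y\<rbrakk> \<Longrightarrow> \<exists>!T. cell_in C T f g"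
  shows "contractible_2cat C"
proof -
  interpret C: strict_2category C by (fact C)
  interpret T: strict_2category terminal_2cat by (fact strict_2category_terminal)
  have "two_functor C terminal_2cat (\<lambda>_. ()) (\<lambda>_. ()) (\<lambda>_. ())"
    by unfold_locales (simp_all add: terminal_2cat_def arr_in_def cell_in_def)
  moreover have "cat_equivalence (hom_cat C X Y) (hom_cat terminal_2cat () ()) (\<lambda>_. ()) (\<lambda>_. ())"
    if X: "X \<in> Obj C" and Y: "Y \<in> Obj C" for X Y
  proof -
    interpret K: category "hom_cat C X Y" by (fact C.category_hom_cat)
    interpret L: category "hom_cat terminal_2cat () ()" by (fact T.category_hom_cat)
    obtain h where h: "arr_in C h X Y" using arr[OF X Y] by blast
    \<comment> \<open>Parallel cells are equal, so the inverse laws and naturality squares below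
      hold once their boundaries match.\<close>
    have uniq: "S = T" if "S \<in> Cell C" "T \<in> Cell C" "csrc C S = csrc C T" "ctrg C S = ctrg C T"
      "arr_in C (csrc C T) X Y" for S T
      using cell[of "csrc C T" X Y "ctrg C T"] that by (auto simp: cell_in_def arr_in_def)
    define \<eta> where "\<eta> f = (THE T. cell_in C T f h)" for f
    have \<eta>: "\<eta> f \<in> Cell C" "csrc C (\<eta> f) = f" "ctrg C (\<eta> f) = h" if "arr_in C f X Y" for f
      using theI'[OF cell[OF that h]] by (auto simp: \<eta>_def cell_in_def)
    have iso: "iso_arrow (hom_cat C X Y) (\<eta> f)" if f: "arr_in C f X Y" for f
    proof -
      obtain S where S: "S \<in> Cell C" "csrc C S = h" "ctrg C S = f"
        using cell[OF h f] by (auto simp: cell_in_def)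
      have "\<eta> f \<bullet>\<^bsub>C\<^esub> S = cid C f" "S \<bullet>\<^bsub>C\<^esub> \<eta> f = cid C h"
        using S \<eta>[OF f] f h unfolding arr_in_def by - (rule uniq; simp add: arr_in_def)+
      with S \<eta>[OF f] f h show ?thesis
        unfolding iso_arrow_def by (intro conjI bexI[of _ S]) simp_all
    qed
    have h': "h \<in> Arr C" "adom C h = X" "acod C h = Y"
      using h by (auto simp: arr_in_def)
    have G: "cat_functor (hom_cat terminal_2cat () ()) (hom_cat C X Y) (\<lambda>_. h) (\<lambda>_. cid C h)"
      by unfold_locales (use h h' in simp_all)
    have F: "cat_functor (hom_cat C X Y) (hom_cat terminal_2cat () ()) (\<lambda>_. ()) (\<lambda>_. ())"
      by unfold_locales (simp_all add: terminal_2cat_def arr_in_def)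
    have I: "cat_functor (hom_cat C X Y) (hom_cat C X Y) id id"
      by unfold_locales simp_all
    have GF: "cat_functor (hom_cat C X Y) (hom_cat C X Y) (\<lambda>_. h) (\<lambda>_. cid C h)"
      by unfold_locales (use h h' in simp_all)
    have IT: "cat_functor (hom_cat terminal_2cat () ()) (hom_cat terminal_2cat () ()) id id"
      "cat_functor (hom_cat terminal_2cat () ()) (hom_cat terminal_2cat () ()) (\<lambda>_. ()) (\<lambda>_. ())"
      by unfold_locales (simp_all add: terminal_2cat_def arr_in_def)
    have "natural_iso (hom_cat C X Y) (hom_cat C X Y) id id (\<lambda>_. h) (\<lambda>_. cid C h) \<eta>"
      unfolding natural_iso_def
    proof (intro conjI ballI I GF)
      fix T assume "T \<in> Ar (hom_cat C X Y)"
      then have T: "T \<in> Cell C" "arr_in C (csrc C T) X Y" "arr_in C (ctrg C T) X Y"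
        by (auto simp: arr_in_def)
      show "Cmp (hom_cat C X Y) (id T) (\<eta> (Cod (hom_cat C X Y) T)) =
          Cmp (hom_cat C X Y) (\<eta> (Dom (hom_cat C X Y) T)) (cid C h)"
        using T \<eta>[OF T(2)] \<eta>[OF T(3)] h' by - (rule uniq; simp)
    qed (use iso \<eta> in auto)
    moreover have "natural_iso (hom_cat terminal_2cat () ()) (hom_cat terminal_2cat () ())
        (\<lambda>_. ()) (\<lambda>_. ()) id id (\<lambda>_. ())"
      unfolding natural_iso_def using IT
      by (simp add: iso_arrow_def terminal_2cat_def arr_in_def)
    ultimately show ?thesis
      unfolding cat_equivalence_def using F G
      by (intro conjI exI[of _ "\<lambda>_. h"] exI[of _ "\<lambda>_. cid C h"] exI[of _ \<eta>] exI[of _ "\<lambda>_. ()"])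
         (simp_all add: comp_def)
  qed
  moreover have "equi_arrow terminal_2cat ()"
    by (auto simp: equi_arrow_def invertible_cell_def terminal_2cat_def arr_in_def cell_in_def)
  ultimately show ?thesis
    using ne unfolding contractible_2cat_def equivalence_2functor_def fully_faithful_2functor_def
    by (auto simp: terminal_2cat_def arr_in_def)
qed


section \<open>The 2-category of units\<close>

context semi_monoidal_2category
begin

lemma unit_morphismD:
  assumes "unit_morphism C (I, \<alpha>) (J, \<beta>) (u, U)"
  shows "unit_object C (I, \<alpha>)" "unit_object C (J, \<beta>)" "equi_arrow C u" "invertible_cell C U"
    and "u \<in> Arr C" "adom C u = I" "acod C u = J"
    and "U \<in> Cell C" "csrc C U = \<alpha> \<sharp> u" "ctrg C U = (u \<otimes> u) \<sharp> \<beta>"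
    and "I \<in> Obj C" "\<alpha> \<in> Arr C" "adom C \<alpha> = I \<odot> I" "acod C \<alpha> = I"
    and "J \<in> Obj C" "\<beta> \<in> Arr C" "adom C \<beta> = J \<odot> J" "acod C \<beta> = J"
  using assms unit_objectD[of I \<alpha>] unit_objectD[of J \<beta>]
  by (auto simp: unit_morphism_def arr_in_def cell_in_def)

lemma unit_2morphismD:
  assumes "unit_2morphism C (I, \<alpha>) (J, \<beta>) (u, U) (v, V) T"
  shows "unit_morphism C (I, \<alpha>) (J, \<beta>) (u, U)" "unit_morphism C (I, \<alpha>) (J, \<beta>) (v, V)"
    and "invertible_cell C T" "T \<in> Cell C" "csrc C T = u" "ctrg C T = v"
    and "U \<bullet> ((T \<boxtimes> T) \<star> cid C \<beta>) = (cid C \<alpha> \<star> T) \<bullet> V"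
  using assms by (auto simp: unit_2morphism_def cell_in_def)

section \<open>Closure of units under the operations of the 2-category\<close>

lemma unit_morphism_id:
  assumes "unit_object C (I, \<alpha>)"
  shows "unit_morphism C (I, \<alpha>) (I, \<alpha>) (aid C I, cid C \<alpha>)"
proof -
  note I = unit_objectD[OF assms]
  have "equi_arrow C (aid C I)"
    using I by (intro equi_arrowI[of _ "aid C I"]) (simp_all add: cell_iso_refl)
  with I assms show ?thesis
    by (simp add: unit_morphism_def arr_in_def cell_in_def invertible_cid)
qed

lemma unit_morphism_comp:
  assumes "unit_morphism C (I, \<alpha>) (J, \<beta>) (u, U)" "unit_morphism C (J, \<beta>) (K, \<gamma>) (v, V)"
  shows "unit_morphism C (I, \<alpha>) (K, \<gamma>)
    (u \<sharp> v, (U \<star> cid C v) \<bullet> (cid C (u \<otimes> u) \<star> V))"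
proof -
  note D = unit_morphismD[OF assms(1)] unit_morphismD[OF assms(2)]
  have "equi_arrow C (u \<sharp> v)"
    using D by (intro equi_arrow_acomp) simp_all
  moreover have "invertible_cell C ((U \<star> cid C v) \<bullet> (cid C (u \<otimes> u) \<star> V))"
    using D by (intro invertible_vcomp invertible_hcomp invertible_cid) (simp_all add: acomp_assoc)
  ultimately show ?thesis
    using D by (simp add: unit_morphism_def arr_in_def cell_in_def acomp_assoc atens_acomp)
qed

lemma unit_2morphism_cid:
  assumes "unit_morphism C (I, \<alpha>) (J, \<beta>) (u, U)"
  shows "unit_2morphism C (I, \<alpha>) (J, \<beta>) (u, U) (u, U) (cid C u)"
  using assms unit_morphismD[OF assms]
  by (simp add: unit_2morphism_def cell_in_def invertible_cid hcomp_cid)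

lemma unit_2morphism_vcomp:
  assumes "unit_2morphism C (I, \<alpha>) (J, \<beta>) (u, U) (v, V) S"
    and "unit_2morphism C (I, \<alpha>) (J, \<beta>) (v, V) (w, W) T"
  shows "unit_2morphism C (I, \<alpha>) (J, \<beta>) (u, U) (w, W) (S \<bullet> T)"
proof -
  note S = unit_2morphismD[OF assms(1)] and T = unit_2morphismD[OF assms(2)]
  note D = S(3-6) T(3-6) unit_morphismD[OF S(1)] unit_morphismD[OF T(1)] unit_morphismD[OF T(2)]
  have 1: "((S \<bullet> T) \<boxtimes> (S \<bullet> T)) \<star> cid C \<beta> = ((S \<boxtimes> S) \<star> cid C \<beta>) \<bullet> ((T \<boxtimes> T) \<star> cid C \<beta>)"
    using D by (simp add: ctens_vcomp flip: interchange)
  have 2: "cid C \<alpha> \<star> (S \<bullet> T) = (cid C \<alpha> \<star> S) \<bullet> (cid C \<alpha> \<star> T)"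
    using D by (simp flip: interchange)
  have "U \<bullet> (((S \<bullet> T) \<boxtimes> (S \<bullet> T)) \<star> cid C \<beta>)
      = (U \<bullet> ((S \<boxtimes> S) \<star> cid C \<beta>)) \<bullet> ((T \<boxtimes> T) \<star> cid C \<beta>)"
    unfolding 1 using D by (simp add: vcomp_assoc)
  also have "\<dots> = (cid C \<alpha> \<star> S) \<bullet> (V \<bullet> ((T \<boxtimes> T) \<star> cid C \<beta>))"
    unfolding S(7) using D by (simp add: vcomp_assoc)
  also have "\<dots> = (cid C \<alpha> \<star> (S \<bullet> T)) \<bullet> W"
    unfolding T(7) 2 using D by (simp add: vcomp_assoc)
  finally have 3: "U \<bullet> (((S \<bullet> T) \<boxtimes> (S \<bullet> T)) \<star> cid C \<beta>) = (cid C \<alpha> \<star> (S \<bullet> T)) \<bullet> W" .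
  have "invertible_cell C (S \<bullet> T)"
    using S T by (intro invertible_vcomp) simp_all
  with 3 S(1) T(2) D(1-8) show ?thesis
    by (simp add: unit_2morphism_def cell_in_def)
qed

text \<open>The two defining equations are pasted side by side: the one for \<open>T\<close> is
  applied first, under \<open>S \<boxtimes> S\<close>, and then the one for \<open>S\<close>, beside
  \<open>T\<close>.\<close>

lemma unit_2morphism_hcomp:
  assumes "unit_2morphism C (I, \<alpha>) (J, \<beta>) (u, U) (u', U') S"
    and "unit_2morphism C (J, \<beta>) (K, \<gamma>) (v, V) (v', V') T"
  shows "unit_2morphism C (I, \<alpha>) (K, \<gamma>)
    (u \<sharp> v, (U \<star> cid C v) \<bullet> (cid C (u \<otimes> u) \<star> V))
    (u' \<sharp> v', (U' \<star> cid C v') \<bullet> (cid C (u' \<otimes> u') \<star> V')) (S \<star> T)"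
proof -
  note S = unit_2morphismD[OF assms(1)] and T = unit_2morphismD[OF assms(2)]
  note D = S(3-6) T(3-6) unit_morphismD(5-)[OF S(1)] unit_morphismD(5-)[OF S(2)]
    unit_morphismD(5-)[OF T(1)] unit_morphismD(5-)[OF T(2)]
  have "((U \<star> cid C v) \<bullet> (cid C (u \<otimes> u) \<star> V)) \<bullet> (((S \<star> T) \<boxtimes> (S \<star> T)) \<star> cid C \<gamma>)
      = (U \<star> cid C v) \<bullet> ((cid C (u \<otimes> u) \<star> V) \<bullet> ((S \<boxtimes> S) \<star> ((T \<boxtimes> T) \<star> cid C \<gamma>)))"
    using D by (simp add: vcomp_assoc hcomp_assoc ctens_hcomp acomp_assoc atens_acomp)
  also have "(cid C (u \<otimes> u) \<star> V) \<bullet> ((S \<boxtimes> S) \<star> ((T \<boxtimes> T) \<star> cid C \<gamma>))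
      = (S \<boxtimes> S) \<star> (V \<bullet> ((T \<boxtimes> T) \<star> cid C \<gamma>))"
    using D by (simp flip: interchange)
  \<comment> \<open>After the equation for \<open>T\<close>, the arrow \<open>\<beta>\<close> stands
    next to \<open>S \<boxtimes> S\<close>, which is where the equation for \<open>S\<close> needs
    it.\<close>
  also have "\<dots> = ((S \<boxtimes> S) \<star> (cid C \<beta> \<star> T)) \<bullet> (cid C (u' \<otimes> u') \<star> V')"
    unfolding T(7) using D by (simp flip: interchange)
  also have "(U \<star> cid C v) \<bullet> (((S \<boxtimes> S) \<star> (cid C \<beta> \<star> T)) \<bullet> (cid C (u' \<otimes> u') \<star> V'))
      = ((U \<star> cid C v) \<bullet> (((S \<boxtimes> S) \<star> cid C \<beta>) \<star> T)) \<bullet> (cid C (u' \<otimes> u') \<star> V')"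
    using D by (simp add: vcomp_assoc hcomp_assoc acomp_assoc)
  also have "(U \<star> cid C v) \<bullet> (((S \<boxtimes> S) \<star> cid C \<beta>) \<star> T) = (U \<bullet> ((S \<boxtimes> S) \<star> cid C \<beta>)) \<star> T"
    using D by (simp flip: interchange)
  also have "\<dots> = ((cid C \<alpha> \<star> S) \<star> T) \<bullet> (U' \<star> cid C v')"
    unfolding S(7) using D by (simp flip: interchange)
  also have "(((cid C \<alpha> \<star> S) \<star> T) \<bullet> (U' \<star> cid C v')) \<bullet> (cid C (u' \<otimes> u') \<star> V')
      = (cid C \<alpha> \<star> (S \<star> T)) \<bullet> ((U' \<star> cid C v') \<bullet> (cid C (u' \<otimes> u') \<star> V'))"
    using D by (simp add: vcomp_assoc hcomp_assoc acomp_assoc)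
  finally have "((U \<star> cid C v) \<bullet> (cid C (u \<otimes> u) \<star> V)) \<bullet> (((S \<star> T) \<boxtimes> (S \<star> T)) \<star> cid C \<gamma>)
      = (cid C \<alpha> \<star> (S \<star> T)) \<bullet> ((U' \<star> cid C v') \<bullet> (cid C (u' \<otimes> u') \<star> V'))" .
  moreover have "invertible_cell C (S \<star> T)"
    using D by (intro invertible_hcomp) simp_all
  ultimately show ?thesis
    using unit_morphism_comp[OF S(1) T(1)] unit_morphism_comp[OF S(2) T(2)] D
    by (simp add: unit_2morphism_def cell_in_def)
qed

text \<open>Both bracketings expand to the same threefold pasting: \<open>U\<close> whiskered by
  \<open>v \<sharp> w\<close>, then \<open>V\<close> whiskered on both sides, then
  \<open>W\<close>.\<close>

lemma unit_comp_assoc: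
  assumes "unit_morphism C (I, \<alpha>) (J, \<beta>) (u, U)" "unit_morphism C (J, \<beta>) (K, \<gamma>) (v, V)"
    and "unit_morphism C (K, \<gamma>) (L, \<delta>) (w, W)"
  shows "(((U \<star> cid C v) \<bullet> (cid C (u \<otimes> u) \<star> V)) \<star> cid C w) \<bullet> (cid C ((u \<sharp> v) \<otimes> (u \<sharp> v)) \<star> W)
    = (U \<star> cid C (v \<sharp> w)) \<bullet> (cid C (u \<otimes> u) \<star> ((V \<star> cid C w) \<bullet> (cid C (v \<otimes> v) \<star> W)))"
proof -
  note D = unit_morphismD(5-)[OF assms(1)] unit_morphismD(5-)[OF assms(2)] unit_morphismD(5-)[OF assms(3)]
  have 1: "((U \<star> cid C v) \<bullet> (cid C (u \<otimes> u) \<star> V)) \<star> cid C w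
      = (U \<star> cid C (v \<sharp> w)) \<bullet> (cid C (u \<otimes> u) \<star> (V \<star> cid C w))"
  proof -
    have "((U \<star> cid C v) \<bullet> (cid C (u \<otimes> u) \<star> V)) \<star> (cid C w \<bullet> cid C w)
        = ((U \<star> cid C v) \<star> cid C w) \<bullet> ((cid C (u \<otimes> u) \<star> V) \<star> cid C w)"
      by (rule interchange) (use D in \<open>simp_all add: acomp_assoc\<close>)
    then show ?thesis
      using D by (simp add: hcomp_assoc hcomp_cid)
  qed
  have 2: "cid C (u \<otimes> u) \<star> ((V \<star> cid C w) \<bullet> (cid C (v \<otimes> v) \<star> W))
      = (cid C (u \<otimes> u) \<star> (V \<star> cid C w)) \<bullet> (cid C ((u \<sharp> v) \<otimes> (u \<sharp> v)) \<star> W)"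
  proof -
    have "(cid C (u \<otimes> u) \<bullet> cid C (u \<otimes> u)) \<star> ((V \<star> cid C w) \<bullet> (cid C (v \<otimes> v) \<star> W))
        = (cid C (u \<otimes> u) \<star> (V \<star> cid C w)) \<bullet> (cid C (u \<otimes> u) \<star> (cid C (v \<otimes> v) \<star> W))"
      by (rule interchange) (use D in \<open>simp_all add: acomp_assoc\<close>)
    moreover have "cid C (u \<otimes> u) \<star> (cid C (v \<otimes> v) \<star> W) = cid C ((u \<sharp> v) \<otimes> (u \<sharp> v)) \<star> W"
      using D by (simp add: atens_acomp flip: hcomp_assoc hcomp_cid)
    ultimately show ?thesis
      using D by simp
  qed
  show ?thesis
    unfolding 1 2 using D by (simp add: vcomp_assoc acomp_assoc atens_acomp)
qed

lemma unit_comp_id_left: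
  assumes "unit_morphism C (I, \<alpha>) (J, \<beta>) (u, U)"
  shows "aid C I \<sharp> u = u"
    and "(cid C \<alpha> \<star> cid C u) \<bullet> (cid C (aid C I \<otimes> aid C I) \<star> U) = U"
  using unit_morphismD[OF assms] by (simp_all add: hcomp_cid)

lemma unit_comp_id_right:
  assumes "unit_morphism C (I, \<alpha>) (J, \<beta>) (u, U)"
  shows "u \<sharp> aid C J = u"
    and "(U \<star> cid C (aid C J)) \<bullet> (cid C (u \<otimes> u) \<star> cid C \<beta>) = U"
  using unit_morphismD[OF assms] by (simp_all add: hcomp_cid)

text \<open>Collected into one conjunction because a destruction step consumes its premise and must
  deliver all boundary facts at once.\<close>

lemma unit_2morphism_boundary:
  assumes "unit_2morphism C (I, \<alpha>) (J, \<beta>) (u, U) (v, V) T"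
  shows "unit_morphism C (I, \<alpha>) (J, \<beta>) (u, U) \<and> unit_morphism C (I, \<alpha>) (J, \<beta>) (v, V) \<and>
    T \<in> Cell C \<and> csrc C T = u \<and> ctrg C T = v \<and> adom C u = I \<and> acod C u = J"
  using unit_2morphismD(1-6)[OF assms] unit_morphismD(6,7)[OF unit_2morphismD(1)[OF assms]] by simp

text \<open>The laws for 2-cells are inherited from \<open>C\<close>. What remains is closure under
  the operations and the laws for the pasted 2-cells that belong to composite arrows.\<close>

lemma strict_2category_unit_2cat: "strict_2category (unit_2cat C)"
proof -
  note sels = arr_in_def cell_in_def unit_morphism_id unit_morphism_comp unit_2morphism_cid
    unit_2morphism_vcomp unit_2morphism_hcomp
  show ?thesis
    unfolding unit_2cat_def
  proof (unfold_locales, goal_cases)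
    case (1 f) then show ?case by (cases f) (auto dest: unit_morphismD)
  next
    case (2 f) then show ?case by (cases f) (auto dest: unit_morphismD)
  next
    case (3 T) then show ?case by (cases T) (auto dest: unit_2morphismD)
  next
    case (4 T) then show ?case by (cases T) (auto dest: unit_2morphismD)
  next
    case (5 T) then show ?case by (cases T) auto
  next
    case (6 T) then show ?case by (cases T) auto
  next
    case (7 X) then show ?case by (cases X) (auto simp: sels)
  next
    case (8 f) then show ?case by (cases f) (auto simp: sels)
  next
    case (9 f g) then show ?case by (cases f; cases g) (auto simp: sels)
  next
    case (10 S T) then show ?case by (cases S; cases T) (auto simp: sels)
  next
    case (11 S T) then show ?case by (cases S; cases T) (auto simp: sels)
  next
    case (12 f) then show ?case by (cases f) (auto simp: unit_comp_id_left)
  next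
    case (13 f) then show ?case by (cases f) (auto simp: unit_comp_id_right)
  next
    case (14 f g h) then show ?case
      by (cases f; cases g; cases h)
         (auto simp: unit_comp_assoc acomp_assoc unit_morphismD)
  next
    case (15 T) then show ?case
      by (cases T) (auto dest!: unit_2morphism_boundary)
  next
    case (16 T) then show ?case
      by (cases T) (auto dest!: unit_2morphism_boundary)
  next
    case (17 R S T) then show ?case
      by (cases R; cases S; cases T) (auto dest!: unit_2morphism_boundary simp: vcomp_assoc)
  next
    case (18 T) then show ?case
      \<comment> \<open>Without \<open>atens_aid\<close> the term keeps the shape
        \<open>aid C I \<otimes> aid C I\<close> in which \<open>unit_comp_id_left\<close> is
        stated.\<close>
      by (cases T) (auto dest!: unit_2morphism_boundary simp: unit_comp_id_left simp del: atens_aid)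
  next
    case (19 T) then show ?case
      by (cases T) (auto dest!: unit_2morphism_boundary simp: unit_comp_id_right)
  next
    case (20 R S T) then show ?case
      by (cases R; cases S; cases T)
         (auto dest!: unit_2morphism_boundary simp: unit_comp_assoc acomp_assoc hcomp_assoc unit_morphismD(5))
  next
    case (21 f g) then show ?case
      by (cases f; cases g) (auto simp: hcomp_cid unit_morphismD)
  next
    case (22 S S' T T') then show ?case
      by (cases S; cases S'; cases T; cases T') (auto dest!: unit_2morphism_boundary simp: interchange)
  qed
qed

end

theorem theoremC:
  fixes C :: "('o, 'a, 'c, 'm) semi_mon_2cat_scheme"
  assumes "semi_monoidal_2category C"
  shows "(Obj (unit_2cat C) \<noteq> {} \<longrightarrow> contractible_2cat (unit_2cat C)) \<and>
    (\<forall>I \<alpha> J \<beta>. unit_object C (I, \<alpha>) \<and> unit_object C (J, \<beta>) \<longrightarrow>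
       (\<exists>u U. unit_morphism C (I, \<alpha>) (J, \<beta>) (u, U))) \<and>
    (\<forall>I \<alpha> J \<beta> u U v V.
       unit_morphism C (I, \<alpha>) (J, \<beta>) (u, U) \<and> unit_morphism C (I, \<alpha>) (J, \<beta>) (v, V) \<longrightarrow>
       (\<exists>!T. unit_2morphism C (I, \<alpha>) (J, \<beta>) (u, U) (v, V) T))"
proof -
  interpret semi_monoidal_2category C by (fact assms)
  have "contractible_2cat (unit_2cat C)" if "Obj (unit_2cat C) \<noteq> {}"
  proof (rule contractible_2catI[OF strict_2category_unit_2cat that])
    fix X Y assume "X \<in> Obj (unit_2cat C)" "Y \<in> Obj (unit_2cat C)"
    then have "unit_object C X" "unit_object C Y"
      by (simp_all add: unit_2cat_def)
    then obtain p where "unit_morphism C X Y p"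
      using unit_morphism_exists by (cases X; cases Y) blast
    then show "\<exists>f. arr_in (unit_2cat C) f X Y"
      by (intro exI[of _ "(X, Y, p)"]) (simp add: unit_2cat_def arr_in_def)
  next
    fix f g X Y assume "arr_in (unit_2cat C) f X Y" "arr_in (unit_2cat C) g X Y"
    then obtain p q where f: "f = (X, Y, p)" "unit_morphism C X Y p"
      and g: "g = (X, Y, q)" "unit_morphism C X Y q"
      by (cases f; cases g) (auto simp: unit_2cat_def arr_in_def)
    have "\<exists>!T. unit_2morphism C X Y p q T"
      using f(2) g(2) unit_2morphism_unique_exists by (cases X; cases Y; cases p; cases q) simp
    then obtain T where T: "unit_2morphism C X Y p q T"
      "\<And>S. unit_2morphism C X Y p q S \<Longrightarrow> S = T" by blast
    show "\<exists>!T. cell_in (unit_2cat C) T f g"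
    \<comment> \<open>The boundary tags of a 2-cell are fixed by \<open>f\<close> and
      \<open>g\<close>, so uniqueness concerns only the underlying cell \<open>T\<close>.\<close>
    proof (rule ex1I[of _ "(X, Y, p, q, T)"])
      fix S assume "cell_in (unit_2cat C) S f g"
      with f g T(2) show "S = (X, Y, p, q, T)"
        by (cases S) (auto simp: unit_2cat_def cell_in_def)
    qed (use f g T(1) in \<open>simp add: unit_2cat_def cell_in_def\<close>)
  qed
  then show ?thesis
    using unit_morphism_exists unit_2morphism_unique_exists by blast
qed

end
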